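(* For every finitely generated group $G$ there is a finitely generated group $H$ with $G\leq H\leq \mathrm{Sym}(G\oplus\mathbb{Z})$ (where $G$ is regarded as a subgroup of $\mathrm{Sym}(G\oplus\mathbb{Z})$ via the left regular action of $G\oplus\mathbb{Z}$ on itself) such that: (1) there is a short exact sequence $1\to N\to H\to G\oplus\mathbb{Z}\to 1$ with $N$ locally finite; (2) the action of $H\leq \mathrm{Sym}(G\oplus\mathbb{Z})$ on the set $G\oplus\mathbb{Z}$ (in which $G$ acts via the left regular action) is highly transitive; (3) $H$ is mixed identity free.
   Context: $\mathrm{Sym}(\Omega)$ is the group of all permutations of the set $\Omega$; $G\oplus\mathbb{Z}$ is the direct product of $G$ with the infinite cyclic group. An action of a group on a set $\Omega$ is $k$-transitive if $|\Omega|\geq k$ and for all $k$-tuples $(x_1,\dots,x_k),(y_1,\dots,y_k)\in\Omega^k$, each with pairwise distinct entries, some group element $g$ satisfies $g\cdot x_i=y_i$ for all $1\le i\le k$. A faithful action is highly transitive if it is $k$-transitive for every $k\in\mathbb{N}$. A group $H$ has a non-trivial mixed identity if there is a non-trivial element $W\in H*\mathbb{Z}$ such that every homomorphism $H*\mathbb{Z}\to H$ restricting to the identity on $H$ maps $W$ to the identity; if there is no such $W$, $H$ is mixed identity free. A group is locally finite if all its finitely generated subgroups are finite. *)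

theory Defs
  imports "HOL-Algebra.Group_Action" "HOL-Algebra.Exact_Sequence"
begin

section \<open>Finiteness conditions and short exact sequences\<close>

definition finitely_generated :: "('a, 'm) monoid_scheme \<Rightarrow> bool" where
  "finitely_generated G \<longleftrightarrow> (\<exists>S. finite S \<and> S \<subseteq> carrier G \<and> generate G S = carrier G)"

definition locally_finite :: "('a, 'm) monoid_scheme \<Rightarrow> bool" where
  "locally_finite G \<longleftrightarrow>
     (\<forall>K. subgroup K G \<and> finitely_generated (G\<lparr>carrier := K\<rparr>) \<longrightarrow> finite K)"

text \<open>The library's \<^const>\<open>short_exact_sequence\<close> requires all groups in the sequence to
  have the same element type; this is its version for groups of different element types.\<close>

definition het_short_exact_sequence ::
  "('a, 'k) monoid_scheme \<Rightarrow> ('a \<Rightarrow> 'b) \<Rightarrow> ('b, 'l) monoid_scheme \<Rightarrow> ('b \<Rightarrow> 'c) \<Rightarrow>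
   ('c, 'm) monoid_scheme \<Rightarrow> bool" where
  "het_short_exact_sequence N i H p Q \<longleftrightarrow>
     group N \<and> group H \<and> group Q \<and>
     i \<in> mon N H \<and> p \<in> epi H Q \<and> i ` carrier N = kernel H Q p"


section \<open>Group actions\<close>

text \<open>Elements of \<^term>\<open>BijGroup S\<close> are extensional functions, hence the restriction to the
  carrier.\<close>

definition left_regular :: "('a, 'm) monoid_scheme \<Rightarrow> 'a \<Rightarrow> 'a \<Rightarrow> 'a" where
  "left_regular G g = (\<lambda>x \<in> carrier G. g \<otimes>\<^bsub>G\<^esub> x)"

definition k_transitive_action ::
  "nat \<Rightarrow> ('a, 'm) monoid_scheme \<Rightarrow> 'b set \<Rightarrow> ('a \<Rightarrow> 'b \<Rightarrow> 'b) \<Rightarrow> bool" where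
  "k_transitive_action k G E \<phi> \<longleftrightarrow>
     group_action G E \<phi> \<and> (infinite E \<or> k \<le> card E) \<and>
     (\<forall>xs ys. length xs = k \<and> distinct xs \<and> set xs \<subseteq> E \<and>
              length ys = k \<and> distinct ys \<and> set ys \<subseteq> E \<longrightarrow>
        (\<exists>g \<in> carrier G. \<forall>i < k. \<phi> g (xs ! i) = ys ! i))"

definition highly_transitive_action ::
  "('a, 'm) monoid_scheme \<Rightarrow> 'b set \<Rightarrow> ('a \<Rightarrow> 'b \<Rightarrow> 'b) \<Rightarrow> bool" where
  "highly_transitive_action G E \<phi> \<longleftrightarrow>
     faithful_action G E \<phi> \<and> (\<forall>k. k_transitive_action k G E \<phi>)"


section \<open>Free products\<close>

text \<open>The free product of two groups is realised as the monoid of words over the disjoint union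
  of the carriers, modulo the congruence that multiplies out adjacent letters from the same
  factor and deletes the identities of the factors.\<close>

definition fp_words ::
  "('a, 'k) monoid_scheme \<Rightarrow> ('b, 'l) monoid_scheme \<Rightarrow> ('a + 'b) list set" where
  "fp_words A B = lists (carrier A <+> carrier B)"

inductive fp_cong ::
  "('a, 'k) monoid_scheme \<Rightarrow> ('b, 'l) monoid_scheme \<Rightarrow> ('a + 'b) list \<Rightarrow> ('a + 'b) list \<Rightarrow> bool"
  for A B where
  fp_refl: "w \<in> fp_words A B \<Longrightarrow> fp_cong A B w w"
| fp_sym: "fp_cong A B u v \<Longrightarrow> fp_cong A B v u"
| fp_trans: "fp_cong A B u v \<Longrightarrow> fp_cong A B v w \<Longrightarrow> fp_cong A B u w"
| fp_append: "fp_cong A B u u' \<Longrightarrow> fp_cong A B v v' \<Longrightarrow> fp_cong A B (u @ v) (u' @ v')"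
| fp_one_left: "fp_cong A B [Inl \<one>\<^bsub>A\<^esub>] []"
| fp_one_right: "fp_cong A B [Inr \<one>\<^bsub>B\<^esub>] []"
| fp_mult_left: "a \<in> carrier A \<Longrightarrow> a' \<in> carrier A \<Longrightarrow>
    fp_cong A B [Inl a, Inl a'] [Inl (a \<otimes>\<^bsub>A\<^esub> a')]"
| fp_mult_right: "b \<in> carrier B \<Longrightarrow> b' \<in> carrier B \<Longrightarrow>
    fp_cong A B [Inr b, Inr b'] [Inr (b \<otimes>\<^bsub>B\<^esub> b')]"

definition fp_class ::
  "('a, 'k) monoid_scheme \<Rightarrow> ('b, 'l) monoid_scheme \<Rightarrow> ('a + 'b) list \<Rightarrow> ('a + 'b) list set" where
  "fp_class A B w = {v. fp_cong A B w v}"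

definition free_product ::
  "('a, 'k) monoid_scheme \<Rightarrow> ('b, 'l) monoid_scheme \<Rightarrow> ('a + 'b) list set monoid" where
  "free_product A B =
     \<lparr>carrier = fp_class A B ` fp_words A B,
      mult = (\<lambda>X Y. \<Union>u \<in> X. \<Union>v \<in> Y. fp_class A B (u @ v)),
      one = fp_class A B []\<rparr>"

definition fp_inl ::
  "('a, 'k) monoid_scheme \<Rightarrow> ('b, 'l) monoid_scheme \<Rightarrow> 'a \<Rightarrow> ('a + 'b) list set" where
  "fp_inl A B a = fp_class A B [Inl a]"

definition fp_inr ::
  "('a, 'k) monoid_scheme \<Rightarrow> ('b, 'l) monoid_scheme \<Rightarrow> 'b \<Rightarrow> ('a + 'b) list set" where
  "fp_inr A B b = fp_class A B [Inr b]"

lemma fp_class_eqI: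
  assumes "fp_cong A B u v"
  shows "fp_class A B u = fp_class A B v"
proof -
  have "fp_cong A B u w \<longleftrightarrow> fp_cong A B v w" for w
    using fp_trans[OF fp_sym[OF assms], of w] fp_trans[OF assms, of w] by (rule iffI)
  then show ?thesis by (simp add: fp_class_def)
qed

lemma fp_class_mult:
  assumes "u \<in> fp_words A B" "v \<in> fp_words A B"
  shows "fp_class A B u \<otimes>\<^bsub>free_product A B\<^esub> fp_class A B v = fp_class A B (u @ v)"
proof -
  have "(\<Union>u' \<in> fp_class A B u. \<Union>v' \<in> fp_class A B v. fp_class A B (u' @ v')) =
        (\<Union>u' \<in> fp_class A B u. \<Union>v' \<in> fp_class A B v. fp_class A B (u @ v))"
    by (intro SUP_cong refl fp_class_eqI fp_append) (simp_all add: fp_class_def fp_sym)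
  moreover have "u \<in> fp_class A B u" "v \<in> fp_class A B v"
    using assms by (simp_all add: fp_class_def fp_refl)
  ultimately show ?thesis
    by (auto simp: free_product_def simp del: UN_simps)
qed

lemma carrier_free_product: "carrier (free_product A B) = fp_class A B ` fp_words A B"
  by (simp add: free_product_def)

lemma fp_words_append: "u \<in> fp_words A B \<Longrightarrow> v \<in> fp_words A B \<Longrightarrow> u @ v \<in> fp_words A B"
  by (simp add: fp_words_def)

lemma group_free_product:
  assumes "group A" "group B"
  shows "group (free_product A B)"
proof -
  interpret A: group A by fact
  interpret B: group B by fact
  have nil: "[] \<in> fp_words A B" by (simp add: fp_words_def)
  have one: "\<one>\<^bsub>free_product A B\<^esub> = fp_class A B []"
    by (simp add: free_product_def)
  have inverse: "\<exists>v \<in> fp_words A B. fp_cong A B (v @ w) []" if "w \<in> fp_words A B" for w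
    using that
  proof (induction w)
    case Nil
    then show ?case using nil fp_refl[OF nil] by (metis append_Nil)
  next
    case (Cons x w)
    then have w: "w \<in> fp_words A B" and x: "x \<in> carrier A <+> carrier B"
      by (auto simp: fp_words_def)
    from Cons.IH[OF w] obtain v where v: "v \<in> fp_words A B" "fp_cong A B (v @ w) []" by blast
    obtain y where y: "y \<in> carrier A <+> carrier B" "fp_cong A B [y, x] []"
    proof (cases x)
      case (Inl a)
      with x have "a \<in> carrier A" by auto
      then show ?thesis
        using that[of "Inl (inv\<^bsub>A\<^esub> a)"] Inl
          fp_trans[OF fp_mult_left[of "inv\<^bsub>A\<^esub> a" A a B]] fp_one_left[of A B] by auto
    next
      case (Inr b)
      with x have "b \<in> carrier B" by auto
      then show ?thesis
        using that[of "Inr (inv\<^bsub>B\<^esub> b)"] Inr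
          fp_trans[OF fp_mult_right[of "inv\<^bsub>B\<^esub> b" B b A]] fp_one_right[of A B] by auto
    qed
    have "fp_cong A B (v @ ([y, x] @ w)) (v @ ([] @ w))"
      by (intro fp_append fp_refl y v w)
    then have "fp_cong A B ((v @ [y]) @ x # w) []"
      using fp_trans[OF _ v(2)] by simp
    moreover have "v @ [y] \<in> fp_words A B" using v y by (auto simp: fp_words_def)
    ultimately show ?case by blast
  qed
  show ?thesis
  proof (rule groupI)
    fix X assume "X \<in> carrier (free_product A B)"
    then obtain w where w: "w \<in> fp_words A B" "X = fp_class A B w" by (auto simp: carrier_free_product)
    from inverse[OF w(1)] obtain v where "v \<in> fp_words A B" "fp_cong A B (v @ w) []" by blast
    then show "\<exists>Y \<in> carrier (free_product A B).
        Y \<otimes>\<^bsub>free_product A B\<^esub> X = \<one>\<^bsub>free_product A B\<^esub>"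
      using w by (auto simp: carrier_free_product one fp_class_mult intro!: fp_class_eqI)
  qed (auto simp: carrier_free_product one fp_class_mult fp_words_append nil)
qed

lemma fp_words_singleton:
  "[Inl a] \<in> fp_words A B \<longleftrightarrow> a \<in> carrier A"
  "[Inr b] \<in> fp_words A B \<longleftrightarrow> b \<in> carrier B"
  by (auto simp: fp_words_def)

lemma fp_inl_hom:
  "fp_inl A B \<in> hom A (free_product A B)"
proof (rule homI)
  fix a a' assume a: "a \<in> carrier A" "a' \<in> carrier A"
  then have "fp_inl A B a \<otimes>\<^bsub>free_product A B\<^esub> fp_inl A B a' = fp_class A B [Inl a, Inl a']"
    by (simp add: fp_inl_def fp_class_mult fp_words_singleton)
  then show "fp_inl A B (a \<otimes>\<^bsub>A\<^esub> a') = fp_inl A B a \<otimes>\<^bsub>free_product A B\<^esub> fp_inl A B a'"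
    using fp_class_eqI[OF fp_mult_left[OF a], of B] by (simp add: fp_inl_def)
qed (auto simp: fp_inl_def carrier_free_product fp_words_singleton)

lemma fp_inr_hom:
  "fp_inr A B \<in> hom B (free_product A B)"
proof (rule homI)
  fix b b' assume b: "b \<in> carrier B" "b' \<in> carrier B"
  then have "fp_inr A B b \<otimes>\<^bsub>free_product A B\<^esub> fp_inr A B b' = fp_class A B [Inr b, Inr b']"
    by (simp add: fp_inr_def fp_class_mult fp_words_singleton)
  then show "fp_inr A B (b \<otimes>\<^bsub>B\<^esub> b') = fp_inr A B b \<otimes>\<^bsub>free_product A B\<^esub> fp_inr A B b'"
    using fp_class_eqI[OF fp_mult_right[OF b], of A] by (simp add: fp_inr_def)
qed (auto simp: fp_inr_def carrier_free_product fp_words_singleton)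

text \<open>The universal property of the free product.\<close>

lemma free_product_lift:
  assumes "group_hom A C f" "group_hom B C g"
  shows "\<exists>h \<in> hom (free_product A B) C.
           (\<forall>a \<in> carrier A. h (fp_inl A B a) = f a) \<and> (\<forall>b \<in> carrier B. h (fp_inr A B b) = g b)"
proof -
  interpret f: group_hom A C f by fact
  interpret g: group_hom B C g by fact
  define ev where "ev w = foldr (\<lambda>x c. case_sum f g x \<otimes>\<^bsub>C\<^esub> c) w \<one>\<^bsub>C\<^esub>" for w
  have ev_Nil: "ev [] = \<one>\<^bsub>C\<^esub>" and ev_Cons: "ev (x # w) = case_sum f g x \<otimes>\<^bsub>C\<^esub> ev w" for x w
    by (simp_all add: ev_def)
  have letter: "case_sum f g x \<in> carrier C" if "x \<in> carrier A <+> carrier B" for x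
    using that by auto
  have ev_closed: "ev w \<in> carrier C" if "w \<in> fp_words A B" for w
    using that by (induction w) (auto simp: ev_Nil ev_Cons fp_words_def intro!: f.H.m_closed)
  have ev_append: "ev (u @ v) = ev u \<otimes>\<^bsub>C\<^esub> ev v" if "u \<in> fp_words A B" "v \<in> fp_words A B" for u v
    using that(1)
  proof (induction u)
    case Nil
    then show ?case using ev_closed[OF that(2)] by (simp add: ev_Nil)
  next
    case (Cons x u)
    then have "x \<in> carrier A <+> carrier B" "u \<in> fp_words A B" by (auto simp: fp_words_def)
    then show ?case
      using Cons.IH letter ev_closed that(2) by (simp add: ev_Cons f.H.m_assoc)
  qed
  have cong: "u \<in> fp_words A B \<and> v \<in> fp_words A B \<and> ev u = ev v" if "fp_cong A B u v" for u v
    using that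
  proof induction
    case (fp_append u u' v v')
    then show ?case by (simp add: fp_words_append ev_append)
  qed (auto simp: fp_words_def ev_Nil ev_Cons)
  define h where "h X = ev (SOME w. w \<in> X)" for X
  have h: "h (fp_class A B w) = ev w" if "w \<in> fp_words A B" for w
  proof -
    have "w \<in> fp_class A B w" using that by (simp add: fp_class_def fp_refl)
    then have "(SOME v. v \<in> fp_class A B w) \<in> fp_class A B w" by (rule someI)
    then show ?thesis unfolding h_def using cong by (auto simp: fp_class_def)
  qed
  have "h \<in> hom (free_product A B) C"
    by (rule homI) (auto simp: carrier_free_product h ev_closed ev_append fp_class_mult fp_words_append)
  moreover have "h (fp_inl A B a) = f a" if "a \<in> carrier A" for a
    using that by (simp add: fp_inl_def h fp_words_singleton ev_Cons ev_Nil)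
  moreover have "h (fp_inr A B b) = g b" if "b \<in> carrier B" for b
    using that by (simp add: fp_inr_def h fp_words_singleton ev_Cons ev_Nil)
  ultimately show ?thesis by blast
qed

lemma free_product_lift_unique:
  assumes "group A" "group B" "group C"
    and "h \<in> hom (free_product A B) C" "h' \<in> hom (free_product A B) C"
    and "\<And>a. a \<in> carrier A \<Longrightarrow> h (fp_inl A B a) = h' (fp_inl A B a)"
    and "\<And>b. b \<in> carrier B \<Longrightarrow> h (fp_inr A B b) = h' (fp_inr A B b)"
    and "X \<in> carrier (free_product A B)"
  shows "h X = h' X"
proof -
  interpret P: group "free_product A B" using assms(1,2) by (rule group_free_product)
  interpret h: group_hom "free_product A B" C h
    using assms by (simp add: group_hom_def group_hom_axioms_def P.is_group)
  interpret h': group_hom "free_product A B" C h'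
    using assms by (simp add: group_hom_def group_hom_axioms_def P.is_group)
  have one: "\<one>\<^bsub>free_product A B\<^esub> = fp_class A B []"
    by (simp add: free_product_def)
  have "h (fp_class A B w) = h' (fp_class A B w)" if "w \<in> fp_words A B" for w
    using that
  proof (induction w)
    case Nil
    then show ?case using h.hom_one h'.hom_one by (simp add: one)
  next
    case (Cons x w)
    then have x: "x \<in> carrier A <+> carrier B" and w: "w \<in> fp_words A B"
      by (auto simp: fp_words_def)
    then have x': "[x] \<in> fp_words A B" by (simp add: fp_words_def)
    have "h (fp_class A B [x]) = h' (fp_class A B [x])"
      using x assms(6,7) by (auto simp: fp_inl_def fp_inr_def)
    moreover have "fp_class A B (x # w) = fp_class A B [x] \<otimes>\<^bsub>free_product A B\<^esub> fp_class A B w"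
      using fp_class_mult[OF x' w] by simp
    ultimately show ?case
      using x' w Cons.IH by (simp add: carrier_free_product)
  qed
  then show ?thesis using assms(8) by (auto simp: carrier_free_product)
qed


section \<open>Mixed identities\<close>

definition is_mixed_identity :: "('a, 'm) monoid_scheme \<Rightarrow> ('a + int) list set \<Rightarrow> bool" where
  "is_mixed_identity H W \<longleftrightarrow>
     W \<in> carrier (free_product H integer_group) \<and>
     (\<forall>\<phi> \<in> hom (free_product H integer_group) H.
        (\<forall>h \<in> carrier H. \<phi> (fp_inl H integer_group h) = h) \<longrightarrow> \<phi> W = \<one>\<^bsub>H\<^esub>)"

definition mixed_identity_free :: "('a, 'm) monoid_scheme \<Rightarrow> bool" where
  "mixed_identity_free H \<longleftrightarrow>
     \<not> (\<exists>W. is_mixed_identity H W \<and> W \<noteq> \<one>\<^bsub>free_product H integer_group\<^esub>)"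

end

theory Submission
  imports Defs
begin

text \<open>Let \<open>S\<close> be the set of multiples of 4 with all base-4 digits in \<open>{0, 1}\<close>. The group \<open>H\<close> is
  generated by the left translations of \<open>G \<times> \<int>\<close> and finitely many involutions \<open>a\<^sub>u\<close>, the product of
  the transpositions of \<open>s\<close> and \<open>s u\<close> for \<open>s \<in> S\<close>. Three features of \<open>S\<close> are used.

  \<^item> \<open>S\<close> splits into uniformly bounded clusters at every scale. An element of \<open>H\<close> is a translation
    away from a neighbourhood of \<open>S\<close>; this translation defines the map to \<open>G \<times> \<int>\<close>, and finitely many
    elements of the kernel act on uniformly bounded blocks, hence generate a finite group.
  \<^item> \<open>S\<close> looks the same around \<open>s\<close> and \<open>s + 4\<^sup>k\<close> for large \<open>k\<close>. Therefore nontrivial elements of \<open>H\<close>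
    have infinite support.
  \<^item> Any finite window contains only 0 of \<open>S \<inter> (S - m)\<close> for a suitable \<open>m \<in> S\<close>. Therefore a
    commutator of \<open>a\<^sub>u\<close> and a translate of \<open>a\<^sub>v\<close> is a single 3-cycle on the window, which gives high
    transitivity.

  A highly transitive group whose nontrivial elements have infinite support is mixed identity
  free: a permutation along which a reduced word moves a point can be prescribed on finitely many
  fresh points.\<close>

section \<open>Subgroups of a symmetric group, and a criterion for high transitivity\<close>

section \<open>Groups of permutations\<close>

locale perm_group =
  fixes \<Omega> :: "'x set" and K :: "('x \<Rightarrow> 'x) set"
  assumes subgroup_BijGroup: "subgroup K (BijGroup \<Omega>)"
begin

abbreviation H where "H \<equiv> (BijGroup \<Omega>)\<lparr>carrier := K\<rparr>"

sublocale H: group H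
  by (rule subgroup.subgroup_is_group[OF subgroup_BijGroup group_BijGroup])

lemma Bij: "h \<in> K \<Longrightarrow> h \<in> Bij \<Omega>"
  using subgroup.subset[OF subgroup_BijGroup] by (auto simp: BijGroup_def)

lemma closed: "h \<in> K \<Longrightarrow> x \<in> \<Omega> \<Longrightarrow> h x \<in> \<Omega>"
  using Bij Bij_imp_funcset by blast

lemma inj: "h \<in> K \<Longrightarrow> inj_on h \<Omega>"
  using Bij by (auto simp: Bij_def bij_betw_def)

lemma mult_apply: "h \<in> K \<Longrightarrow> k \<in> K \<Longrightarrow> x \<in> \<Omega> \<Longrightarrow> (h \<otimes>\<^bsub>BijGroup \<Omega>\<^esub> k) x = h (k x)"
  by (simp add: BijGroup_def Bij compose_eq)

lemma mult_closed: "h \<in> K \<Longrightarrow> k \<in> K \<Longrightarrow> h \<otimes>\<^bsub>BijGroup \<Omega>\<^esub> k \<in> K"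
  using H.m_closed by simp

lemma one_closed: "\<one>\<^bsub>BijGroup \<Omega>\<^esub> \<in> K"
  using H.one_closed by simp

lemma one_apply: "x \<in> \<Omega> \<Longrightarrow> \<one>\<^bsub>BijGroup \<Omega>\<^esub> x = x"
  by (simp add: BijGroup_def)

lemma inv_closed: "h \<in> K \<Longrightarrow> inv\<^bsub>BijGroup \<Omega>\<^esub> h \<in> K"
  using subgroup.m_inv_closed[OF subgroup_BijGroup] .

lemma inv_H: "h \<in> K \<Longrightarrow> inv\<^bsub>H\<^esub> h = inv\<^bsub>BijGroup \<Omega>\<^esub> h"
  using group.m_inv_consistent[OF group_BijGroup subgroup_BijGroup] .

lemma inv_apply: "h \<in> K \<Longrightarrow> x \<in> \<Omega> \<Longrightarrow> (inv\<^bsub>BijGroup \<Omega>\<^esub> h) (h x) = x"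
  using H.l_inv[of h] mult_apply[OF inv_closed, of h h x] by (simp add: inv_H one_apply)

lemma apply_inv: "h \<in> K \<Longrightarrow> x \<in> \<Omega> \<Longrightarrow> h ((inv\<^bsub>BijGroup \<Omega>\<^esub> h) x) = x"
  using H.r_inv[of h] mult_apply[OF _ inv_closed, of h h x] by (simp add: inv_H one_apply)

lemma eqI:
  assumes "h \<in> K" "k \<in> K" "\<And>x. x \<in> \<Omega> \<Longrightarrow> h x = k x"
  shows "h = k"
  using Bij[OF assms(1)] Bij[OF assms(2)] assms(3)
  by (auto simp: Bij_def intro: extensionalityI)

lemma nontrivial_moves:
  assumes "h \<in> K" "h \<noteq> \<one>\<^bsub>BijGroup \<Omega>\<^esub>"
  obtains x where "x \<in> \<Omega>" "h x \<noteq> x"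
  using eqI[OF assms(1) one_closed] assms(2) one_apply by metis

lemma faithful_action: "faithful_action H \<Omega> (\<lambda>h. h)"
proof -
  have "(\<lambda>h. h) \<in> hom H (BijGroup \<Omega>)"
    using subgroup.subset[OF subgroup_BijGroup] by (auto simp: hom_def)
  then show ?thesis
    by (simp add: faithful_action_def faithful_action_axioms_def group_action_def group_hom_def
      group_hom_axioms_def H.is_group group_BijGroup)
qed

text \<open>The base points of a tuple are moved to their targets one after the other, each time by an
  element that fixes the targets already reached.\<close>

lemma highly_transitive_actionI:
  assumes inf: "infinite \<Omega>"
    and move: "\<And>R x y. finite R \<Longrightarrow> x \<in> \<Omega> - R \<Longrightarrow> y \<in> \<Omega> - R \<Longrightarrow>
      \<exists>h \<in> K. h x = y \<and> (\<forall>r \<in> R \<inter> \<Omega>. h r = r)"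
  shows "highly_transitive_action H \<Omega> (\<lambda>h. h)"
proof -
  have ex: "\<exists>h \<in> K. map h xs = ys"
    if "length xs = length ys" "distinct xs" "set xs \<subseteq> \<Omega>" "distinct ys" "set ys \<subseteq> \<Omega>" for xs ys
    using that
  proof (induction xs ys rule: list_induct2)
    case Nil
    then show ?case using one_closed by auto
  next
    case (Cons x xs y ys)
    then obtain h where h: "h \<in> K" "map h xs = ys" by auto
    have "h x \<notin> set ys"
    proof
      assume "h x \<in> set ys"
      then obtain x' where "x' \<in> set xs" "h x = h x'" using h by auto
      then show False using inj[OF h(1)] Cons.prems by (auto dest: inj_onD)
    qed
    then obtain k where k: "k \<in> K" "k (h x) = y" "\<forall>r \<in> set ys \<inter> \<Omega>. k r = r"
      using move[of "set ys" "h x" y] closed[OF h(1)] Cons.prems by auto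
    have "k (h z) = h z" if "z \<in> set xs" for z
      using that h k(3) closed[OF h(1), of z] Cons.prems by auto
    then have "map (k \<otimes>\<^bsub>BijGroup \<Omega>\<^esub> h) xs = ys"
      using h k Cons.prems(2) by (auto simp: mult_apply subset_eq intro!: map_cong)
    moreover have "(k \<otimes>\<^bsub>BijGroup \<Omega>\<^esub> h) x = y"
      using h k Cons.prems(2) by (simp add: mult_apply)
    ultimately show ?case
      using mult_closed[OF k(1) h(1)] by (intro bexI[of _ "k \<otimes>\<^bsub>BijGroup \<Omega>\<^esub> h"]) simp_all
  qed
  have "k_transitive_action k H \<Omega> (\<lambda>h. h)" for k
    unfolding k_transitive_action_def
  proof (intro conjI allI impI)
    show "group_action H \<Omega> (\<lambda>h. h)" using faithful_action by (simp add: faithful_action_def)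
    show "infinite \<Omega> \<or> k \<le> card \<Omega>" using inf by simp
    fix xs ys
    assume *: "length xs = k \<and> distinct xs \<and> set xs \<subseteq> \<Omega> \<and> length ys = k \<and> distinct ys \<and> set ys \<subseteq> \<Omega>"
    then obtain h where "h \<in> K" "map h xs = ys" using ex[of xs ys] by auto
    moreover from this have "\<forall>i < k. h (xs ! i) = ys ! i"
      using * by (metis nth_map)
    ultimately show "\<exists>g\<in>carrier H. \<forall>i<k. g (xs ! i) = ys ! i" by auto
  qed
  then show ?thesis using faithful_action unfolding highly_transitive_action_def by blast
qed

text \<open>Listed without repetition, \<open>\<pi>\<close> becomes a pair of tuples with distinct
  entries, to which transitivity for the length of the list applies.\<close>

lemma extend_finite_injection:
  assumes "highly_transitive_action H \<Omega> (\<lambda>h. h)"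
    and "finite \<pi>" "\<pi> \<subseteq> \<Omega> \<times> \<Omega>" "inj_on fst \<pi>" "inj_on snd \<pi>"
  obtains h where "h \<in> K" "\<And>a b. (a, b) \<in> \<pi> \<Longrightarrow> h a = b"
proof -
  obtain l where l: "set l = \<pi>" "distinct l" using finite_distinct_list[OF assms(2)] by blast
  have "distinct (map fst l)" "distinct (map snd l)" using assms l by (auto simp: distinct_map)
  moreover have "set (map fst l) \<subseteq> \<Omega>" "set (map snd l) \<subseteq> \<Omega>" using assms l by auto
  moreover have k: "k_transitive_action (length l) H \<Omega> (\<lambda>h. h)"
    using assms(1) unfolding highly_transitive_action_def by blast
  ultimately have "\<exists>h \<in> carrier H. \<forall>i < length l. h (map fst l ! i) = map snd l ! i"
    by (intro mp[OF spec[OF spec[OF conjunct2[OF conjunct2[OF k[unfolded k_transitive_action_def]]]]]])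
      simp
  then obtain h where h: "h \<in> K" "\<forall>i < length l. h (map fst l ! i) = map snd l ! i" by auto
  have "h a = b" if "(a, b) \<in> \<pi>" for a b
  proof -
    obtain i where "i < length l" "l ! i = (a, b)" using \<open>(a, b) \<in> \<pi>\<close> l(1) by (metis in_set_conv_nth)
    then show ?thesis using h(2) by force
  qed
  with h(1) that show thesis by blast
qed

end

section \<open>Finiteness of groups acting on uniformly bounded blocks\<close>

section \<open>Local finiteness\<close>

text \<open>Every group element is determined by the relations it induces on the common coordinate set of
  the blocks, and blocks on which all generators induce the same relations also have equal
  relations for every element. Since there are finitely many possible relations for each of the
  finitely many generators, finitely many blocks suffice to recover an element.\<close>

lemma finite_generate_of_blocks:
  fixes \<sigma> :: "'q \<Rightarrow> 'c \<Rightarrow> 'x"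
  assumes T: "finite T" "T \<subseteq> Bij \<Omega>"
    and X: "finite X" "\<And>q. inj_on (\<sigma> q) X" "\<And>q. \<sigma> q ` X \<subseteq> \<Omega>"
    and block: "\<And>t q. t \<in> T \<Longrightarrow> t ` \<sigma> q ` X \<subseteq> \<sigma> q ` X"
    and fixed: "\<And>t x. t \<in> T \<Longrightarrow> x \<in> \<Omega> - (\<Union>q. \<sigma> q ` X) \<Longrightarrow> t x = x"
  shows "finite (generate (BijGroup \<Omega>) T)"
proof -
  have sg: "subgroup (generate (BijGroup \<Omega>) T) (BijGroup \<Omega>)"
    using T(2) by (intro group.generate_is_subgroup group_BijGroup) (simp add: BijGroup_def)
  interpret perm_group \<Omega> "generate (BijGroup \<Omega>) T" by (rule perm_group.intro[OF sg])
  let ?K = "generate (BijGroup \<Omega>) T"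
  define rel where "rel k q = {(b, b') \<in> X \<times> X. k (\<sigma> q b) = \<sigma> q b'}" for k q
  have K_block: "k ` \<sigma> q ` X \<subseteq> \<sigma> q ` X" if "k \<in> ?K" for k q
    using that
  proof induction
    case one
    have "\<one>\<^bsub>BijGroup \<Omega>\<^esub> ` \<sigma> q ` X = id ` \<sigma> q ` X"
      using X(3)[of q] by (intro image_cong refl) (auto intro!: one_apply)
    then show ?case by simp
  next
    case (incl t)
    then show ?case by (rule block)
  next
    case (inv t)
    have t: "t \<in> ?K" using inv by (rule generate.incl)
    \<comment> \<open>An injective self-map of a finite block is onto, so the inverse preserves the
      block as well.\<close>
    have "t ` \<sigma> q ` X = \<sigma> q ` X"
      by (rule endo_inj_surj[OF finite_imageI[OF X(1)] block[OF inv] inj_on_subset[OF inj[OF t] X(3)]])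
    then have ex: "\<exists>y \<in> \<sigma> q ` X. x = t y" if "x \<in> \<sigma> q ` X" for x
      using that by blast
    have "(inv\<^bsub>BijGroup \<Omega>\<^esub> t) x \<in> \<sigma> q ` X" if "x \<in> \<sigma> q ` X" for x
    proof -
      obtain y where "y \<in> \<sigma> q ` X" "x = t y" using ex[OF \<open>x \<in> \<sigma> q ` X\<close>] by blast
      moreover from this have "(inv\<^bsub>BijGroup \<Omega>\<^esub> t) (t y) = y"
        using X(3) by (intro inv_apply[OF t]) blast
      ultimately show ?thesis by simp
    qed
    then show ?case by blast
  next
    case (eng h1 h2)
    have "(h1 \<otimes>\<^bsub>BijGroup \<Omega>\<^esub> h2) x \<in> \<sigma> q ` X" if "x \<in> \<sigma> q ` X" for x
    proof -
      have "x \<in> \<Omega>" using that X(3) by blast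
      then have "(h1 \<otimes>\<^bsub>BijGroup \<Omega>\<^esub> h2) x = h1 (h2 x)"
        using eng.hyps by (intro mult_apply)
      then show ?thesis using eng.IH that by blast
    qed
    then show ?case by blast
  qed
  have K_fixed: "k x = x" if "k \<in> ?K" "x \<in> \<Omega> - (\<Union>q. \<sigma> q ` X)" for k x
    using that
  proof induction
    case one
    then show ?case by (simp add: one_apply)
  next
    case (incl t)
    then show ?case by (rule fixed)
  next
    case (inv t)
    have t: "t \<in> ?K" using inv(1) by (rule generate.incl)
    have "t x = x" by (rule fixed[OF inv])
    then show ?case using inv_apply[OF t, of x] inv(2) by simp
  next
    case (eng h1 h2)
    have "x \<in> \<Omega>" using eng.prems by simp
    then show ?case using eng.IH[OF eng.prems] mult_apply[OF eng.hyps(1,2), of x] by simp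
  qed
  have rel_eq: "rel k q = rel k q'" if "k \<in> ?K" and eq: "\<And>t. t \<in> T \<Longrightarrow> rel t q = rel t q'" for k q q'
    using that(1)
  proof induction
    case one
    have "rel (\<one>\<^bsub>BijGroup \<Omega>\<^esub>) q = Id_on X" for q
      using X(2)[of q] X(3)[of q] by (auto simp: rel_def one_apply image_subset_iff dest: inj_onD)
    then show ?case by simp
  next
    case (inv t)
    have t: "t \<in> ?K" using inv(1) by (rule generate.incl)
    have "(inv\<^bsub>BijGroup \<Omega>\<^esub> t) (\<sigma> q b) = \<sigma> q b' \<longleftrightarrow> t (\<sigma> q b') = \<sigma> q b"
      if "b \<in> X" "b' \<in> X" for q b b'
    proof -
      have "\<sigma> q b \<in> \<Omega>" "\<sigma> q b' \<in> \<Omega>" using X(3)[of q] that by auto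
      then show ?thesis using inv_apply[OF t] apply_inv[OF t] by metis
    qed
    then have "rel (inv\<^bsub>BijGroup \<Omega>\<^esub> t) q = (rel t q)\<inverse>" for q
      by (auto simp: rel_def)
    then show ?case using eq[OF inv] by simp
  next
    case (eng h1 h2)
    \<comment> \<open>The relational product \<open>O\<close> applies its left argument first, hence
      the reversed order. The intermediate point exists by \<open>K_block\<close>.\<close>
    have "rel (h1 \<otimes>\<^bsub>BijGroup \<Omega>\<^esub> h2) q = rel h2 q O rel h1 q" for q
    proof -
      have *: "(h1 \<otimes>\<^bsub>BijGroup \<Omega>\<^esub> h2) (\<sigma> q b) = h1 (h2 (\<sigma> q b))" if "b \<in> X" for b
        using that X(3)[of q] eng.hyps by (auto intro!: mult_apply)
      moreover have "\<exists>c \<in> X. h2 (\<sigma> q b) = \<sigma> q c" if "b \<in> X" for b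
        using that K_block[OF eng.hyps(2), of q] by auto
      ultimately show ?thesis by (force simp: rel_def)
    qed
    then show ?case using eng.IH by simp
  qed (rule eq)
  \<comment> \<open>\<open>ty q\<close> records how all generators act on block \<open>q\<close>. It
    takes finitely many values, and \<open>Q\<close> is a finite set of blocks realising all of
    them.\<close>
  define ty where "ty q = (\<lambda>t \<in> T. rel t q)" for q
  have "range ty \<subseteq> (T \<rightarrow>\<^sub>E Pow (X \<times> X))" by (auto simp: ty_def rel_def)
  then have "finite (range ty)"
    by (rule finite_subset) (simp add: finite_PiE T(1) X(1))
  then obtain Q where Q: "finite Q" "range ty = ty ` Q"
    using finite_subset_image[of "range ty" ty UNIV] by blast
  have rep: "\<exists>q' \<in> Q. \<forall>k \<in> ?K. rel k q = rel k q'" for q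
  proof -
    obtain q' where "q' \<in> Q" "ty q = ty q'" using Q(2) by (metis imageE rangeI)
    moreover from this have "rel t q = rel t q'" if "t \<in> T" for t
      using that by (metis ty_def restrict_apply')
    ultimately show ?thesis using rel_eq by blast
  qed
  have "inj_on (\<lambda>k. \<lambda>q \<in> Q. rel k q) ?K"
  proof (rule inj_onI)
    fix h k assume hk: "h \<in> ?K" "k \<in> ?K" "(\<lambda>q \<in> Q. rel h q) = (\<lambda>q \<in> Q. rel k q)"
    have rel: "rel h q = rel k q" for q
      using rep[of q] hk by (metis restrict_apply')
    show "h = k"
    proof (rule eqI[OF hk(1,2)])
      fix x assume x: "x \<in> \<Omega>"
      show "h x = k x"
      proof (cases "x \<in> (\<Union>q. \<sigma> q ` X)")
        case True
        then obtain q b where qb: "b \<in> X" "x = \<sigma> q b" by auto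
        then obtain b' where "b' \<in> X" "h x = \<sigma> q b'" using K_block[OF hk(1), of q] by auto
        with qb have "(b, b') \<in> rel k q" using rel[of q] by (auto simp: rel_def)
        with qb \<open>h x = \<sigma> q b'\<close> show ?thesis by (simp add: rel_def)
      next
        case False
        then show ?thesis using K_fixed[of h x] K_fixed[of k x] hk x by simp
      qed
    qed
  qed
  moreover have "(\<lambda>k. \<lambda>q \<in> Q. rel k q) ` ?K \<subseteq> (Q \<rightarrow>\<^sub>E Pow (X \<times> X))"
    by (auto simp: rel_def)
  then have "finite ((\<lambda>k. \<lambda>q \<in> Q. rel k q) ` ?K)"
    by (rule finite_subset) (simp add: finite_PiE Q(1) X(1))
  ultimately show ?thesis using finite_imageD by blast
qed

section \<open>Reduced words over a group and one further generator of infinite order\<close>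

section \<open>Normal forms in free products with the integers\<close>

text \<open>The value of a word \<open>g x^e1 g1 x^e2 g2 ...\<close>. The target group, the
  coefficient map and the value of \<open>x\<close> are parameters, so one list can be evaluated in
  the free product and in any group that it maps to.\<close>

fun syllables :: "('c, 'm) monoid_scheme \<Rightarrow> ('a \<Rightarrow> 'c) \<Rightarrow> 'c \<Rightarrow> 'a \<Rightarrow> (int \<times> 'a) list \<Rightarrow> 'c" where
  "syllables C f x g [] = f g"
| "syllables C f x g ((e, g') # ls) = f g \<otimes>\<^bsub>C\<^esub> (x [^]\<^bsub>C\<^esub> e \<otimes>\<^bsub>C\<^esub> syllables C f x g' ls)"

text \<open>Each coefficient follows the letter it is paired with. Exponents are 1 or -1, so higher
  powers of \<open>x\<close> are spelled with trivial coefficients in between, and the condition on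
  neighbours excludes exactly the subwords \<open>x^e \<one> x^-e\<close>.\<close>

definition reduced :: "('a, 'm) monoid_scheme \<Rightarrow> (int \<times> 'a) list \<Rightarrow> bool" where
  "reduced A ls \<longleftrightarrow> set ls \<subseteq> {1, -1} \<times> carrier A \<and>
     successively (\<lambda>(e, g) (e', _). g = \<one>\<^bsub>A\<^esub> \<longrightarrow> e = e') ls"

lemma reduced_Cons:
  "reduced A ((e, g) # ls) \<longleftrightarrow> e \<in> {1, -1} \<and> g \<in> carrier A \<and> reduced A ls \<and>
     (ls \<noteq> [] \<and> g = \<one>\<^bsub>A\<^esub> \<longrightarrow> e = fst (hd ls))"
  by (cases ls) (auto simp: reduced_def)

lemma (in group) syllables_closed:
  assumes "f \<in> carrier A \<rightarrow> carrier G" "x \<in> carrier G" "g \<in> carrier A" "set ls \<subseteq> UNIV \<times> carrier A"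
  shows "syllables G f x g ls \<in> carrier G"
  using assms(3,4)
proof (induction ls arbitrary: g)
  case Nil
  then show ?case using assms(1) by auto
next
  case (Cons eg ls)
  obtain e g' where "eg = (e, g')" by force
  then show ?case using Cons assms(1,2) by (auto intro!: m_closed)
qed

lemma (in group_hom) hom_syllables:
  assumes "f \<in> carrier A \<rightarrow> carrier G" "x \<in> carrier G" "g \<in> carrier A" "set ls \<subseteq> UNIV \<times> carrier A"
  shows "h (syllables G f x g ls) = syllables H (h \<circ> f) (h x) g ls"
  using assms(3,4)
proof (induction ls arbitrary: g)
  case Nil
  then show ?case by simp
next
  case (Cons eg ls)
  obtain e g' where eg: "eg = (e, g')" by force
  have "syllables G f x g' ls \<in> carrier G"
    using assms(1,2) Cons.prems eg by (intro G.syllables_closed[where A = A]) auto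
  moreover have "f g \<in> carrier G" using assms Cons.prems by auto
  ultimately show ?case using Cons assms(2) eg by (simp add: hom_int_pow int_pow_closed)
qed

text \<open>Elements of this form include the identity and are closed under left multiplication by
  letters: a group element is absorbed into the leading coefficient, and \<open>x\<close> or its
  inverse is prepended or cancels. Induction on a representing word then reaches every
  element.\<close>

lemma free_product_normal_form:
  assumes A: "group A" and W: "W \<in> carrier (free_product A integer_group)"
  shows "\<exists>g \<in> carrier A. \<exists>ls. reduced A ls \<and>
    W = syllables (free_product A integer_group) (fp_inl A integer_group) (fp_inr A integer_group 1) g ls"
proof -
  let ?P = "free_product A integer_group"
  let ?\<iota> = "fp_inl A integer_group" and ?x = "fp_inr A integer_group 1"
  interpret A: group A by fact
  interpret P: group ?P using A by (rule group_free_product) simp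
  interpret \<iota>: group_hom A ?P ?\<iota>
    by (simp add: group_hom_def group_hom_axioms_def A P.is_group fp_inl_hom)
  interpret \<xi>: group_hom integer_group ?P "fp_inr A integer_group"
    by (simp add: group_hom_def group_hom_axioms_def P.is_group fp_inr_hom)
  let ?nf = "\<lambda>W. \<exists>g \<in> carrier A. \<exists>ls. reduced A ls \<and> W = syllables ?P ?\<iota> ?x g ls"
  have x: "?x \<in> carrier ?P" using \<xi>.hom_closed[of 1] by simp
  have \<xi>_pow: "fp_inr A integer_group n = ?x [^]\<^bsub>?P\<^esub> n" for n
    using \<xi>.hom_int_pow[of 1 n] by simp
  have syl: "syllables ?P ?\<iota> ?x g ls \<in> carrier ?P" if "g \<in> carrier A" "reduced A ls" for g ls
    using that x by (intro P.syllables_closed[where A = A]) (auto simp: reduced_def)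
  have nf_closed: "W \<in> carrier ?P" if "?nf W" for W using that syl by auto
  have nf_left: "?nf (?\<iota> a \<otimes>\<^bsub>?P\<^esub> W)" if a: "a \<in> carrier A" and "?nf W" for a W
  proof -
    from that(2) obtain g ls where W: "g \<in> carrier A" "reduced A ls" "W = syllables ?P ?\<iota> ?x g ls" by blast
    have "?\<iota> a \<otimes>\<^bsub>?P\<^esub> W = syllables ?P ?\<iota> ?x (a \<otimes>\<^bsub>A\<^esub> g) ls"
    proof (cases ls)
      case Nil
      then show ?thesis using W a by simp
    next
      case (Cons eg ls')
      obtain e g' where eg: "eg = (e, g')" by force
      have "syllables ?P ?\<iota> ?x g' ls' \<in> carrier ?P"
        using W(2) Cons eg by (intro syl) (simp_all add: reduced_Cons)
      then show ?thesis using W a Cons eg x by (simp add: P.m_assoc)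
    qed
    then show ?thesis using W a by blast
  qed
  have nf_step: "?nf (?x [^]\<^bsub>?P\<^esub> e \<otimes>\<^bsub>?P\<^esub> W)" if e: "e \<in> {1, -1 :: int}" and "?nf W" for e W
  proof -
    from that(2) obtain g ls where W: "g \<in> carrier A" "reduced A ls" "W = syllables ?P ?\<iota> ?x g ls" by blast
    show ?thesis
    proof (cases "ls \<noteq> [] \<and> g = \<one>\<^bsub>A\<^esub> \<and> e \<noteq> fst (hd ls)")
      case True
      \<comment> \<open>The new letter meets its inverse across a trivial coefficient. Both
        disappear, and the tail is again reduced.\<close>
      then obtain e' g' ls' where ls: "ls = (e', g') # ls'" "e \<noteq> e'" by (cases ls) auto
      then have e': "e' = - e" using W(2) e by (auto simp: reduced_Cons)
      have V: "g' \<in> carrier A" "reduced A ls'" using W(2) ls by (simp_all add: reduced_Cons)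
      have "?x [^]\<^bsub>?P\<^esub> e \<otimes>\<^bsub>?P\<^esub> W =
          (?x [^]\<^bsub>?P\<^esub> e \<otimes>\<^bsub>?P\<^esub> ?x [^]\<^bsub>?P\<^esub> (- e)) \<otimes>\<^bsub>?P\<^esub> syllables ?P ?\<iota> ?x g' ls'"
        using W True ls e' syl[OF V] x by (simp add: P.m_assoc)
      also have "\<dots> = syllables ?P ?\<iota> ?x g' ls'"
        using syl[OF V] x by (simp flip: P.int_pow_mult)
      finally show ?thesis using V by blast
    next
      case False
      then have "reduced A ((e, g) # ls)" using W e by (auto simp: reduced_Cons)
      moreover have "?x [^]\<^bsub>?P\<^esub> e \<otimes>\<^bsub>?P\<^esub> W = syllables ?P ?\<iota> ?x \<one>\<^bsub>A\<^esub> ((e, g) # ls)"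
        using W syl[OF W(1,2)] x by simp
      ultimately show ?thesis by blast
    qed
  qed
  \<comment> \<open>A letter from the integers is treated as repeated multiplication by
    \<open>x\<close> or by its inverse.\<close>
  have nf_pow: "?nf (?x [^]\<^bsub>?P\<^esub> n \<otimes>\<^bsub>?P\<^esub> W)" if "?nf W" for n :: int and W
  proof (induction n rule: int_induct[where k = 0])
    case base
    then show ?case using that nf_closed[OF that] by simp
  next
    case (step1 i)
    have "?x [^]\<^bsub>?P\<^esub> (i + 1) = ?x [^]\<^bsub>?P\<^esub> (1 :: int) \<otimes>\<^bsub>?P\<^esub> ?x [^]\<^bsub>?P\<^esub> i"
      using x P.int_pow_mult[of ?x 1 i] by (simp add: add.commute)
    then have "?x [^]\<^bsub>?P\<^esub> (i + 1) \<otimes>\<^bsub>?P\<^esub> W = ?x [^]\<^bsub>?P\<^esub> (1 :: int) \<otimes>\<^bsub>?P\<^esub> (?x [^]\<^bsub>?P\<^esub> i \<otimes>\<^bsub>?P\<^esub> W)"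
      using x nf_closed[OF that] by (simp add: P.m_assoc)
    then show ?case using nf_step[of 1, OF _ step1(2)] by (metis insertI1)
  next
    case (step2 i)
    have "?x [^]\<^bsub>?P\<^esub> (i - 1) = ?x [^]\<^bsub>?P\<^esub> (-1 :: int) \<otimes>\<^bsub>?P\<^esub> ?x [^]\<^bsub>?P\<^esub> i"
      using x P.int_pow_mult[of ?x "-1" i] by simp
    then have "?x [^]\<^bsub>?P\<^esub> (i - 1) \<otimes>\<^bsub>?P\<^esub> W = ?x [^]\<^bsub>?P\<^esub> (-1 :: int) \<otimes>\<^bsub>?P\<^esub> (?x [^]\<^bsub>?P\<^esub> i \<otimes>\<^bsub>?P\<^esub> W)"
      using x nf_closed[OF that] by (simp add: P.m_assoc)
    then show ?case using nf_step[of "-1", OF _ step2(2)] by (metis insertI1 insertI2)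
  qed
  have "?nf (fp_class A integer_group w)" if "w \<in> fp_words A integer_group" for w
    using that
  proof (induction w)
    case Nil
    have "fp_class A integer_group [] = \<one>\<^bsub>?P\<^esub>" by (simp add: free_product_def)
    also have "\<dots> = syllables ?P ?\<iota> ?x \<one>\<^bsub>A\<^esub> []" by simp
    finally show ?case by (intro bexI[of _ "\<one>\<^bsub>A\<^esub>"] exI[of _ "[]"]) (simp_all add: reduced_def)
  next
    case (Cons y w)
    then have w: "?nf (fp_class A integer_group w)" "w \<in> fp_words A integer_group" by (auto simp: fp_words_def)
    have y: "[y] \<in> fp_words A integer_group" using Cons.prems by (auto simp: fp_words_def)
    have eq: "fp_class A integer_group (y # w) = fp_class A integer_group [y] \<otimes>\<^bsub>?P\<^esub> fp_class A integer_group w"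
      using fp_class_mult[OF y w(2)] by simp
    show ?case
    proof (cases y)
      case (Inl a)
      then have "a \<in> carrier A" using y by (simp add: fp_words_singleton)
      from nf_left[OF this w(1)] show ?thesis using eq Inl by (simp flip: fp_inl_def)
    next
      case (Inr n)
      have "fp_class A integer_group [Inr n] = ?x [^]\<^bsub>?P\<^esub> n"
        using \<xi>_pow[of n] by (simp only: fp_inr_def)
      then show ?thesis using nf_pow[OF w(1), of n] by (simp only: eq[unfolded Inr] Inr)
    qed
  qed
  then show ?thesis using W by (auto simp: carrier_free_product)
qed

section \<open>Absence of mixed identities from high transitivity and infinite supports\<close>

section \<open>Highly transitive groups without finitary elements\<close>

context perm_group
begin

text \<open>The action of a word without its leading coefficient. The end of the list acts first, so
  the head describes the last step.\<close>

fun trajectory :: "('x \<Rightarrow> 'x) \<Rightarrow> (int \<times> ('x \<Rightarrow> 'x)) list \<Rightarrow> 'x \<Rightarrow> 'x" where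
  "trajectory h [] y = y"
| "trajectory h ((e, g) # ls) y = (h [^]\<^bsub>H\<^esub> e) (g (trajectory h ls y))"

lemma syllables_apply:
  assumes "h \<in> K" "g \<in> K" "set ls \<subseteq> UNIV \<times> K" "y \<in> \<Omega>"
  shows "syllables H (\<lambda>k. k) h g ls y = g (trajectory h ls y)"
  using assms(2,3)
proof (induction ls arbitrary: g)
  case Nil
  then show ?case by simp
next
  case (Cons eg ls)
  obtain e g' where eg: "eg = (e, g')" by force
  have s: "syllables H (\<lambda>k. k) h g' ls \<in> K"
    using H.syllables_closed[of "\<lambda>k. k" H h g' ls] assms Cons.prems eg by auto
  have p: "h [^]\<^bsub>H\<^esub> e \<in> K" using H.int_pow_closed[of h e] assms by simp
  have "syllables H (\<lambda>k. k) h g (eg # ls) y = g ((h [^]\<^bsub>H\<^esub> e) (syllables H (\<lambda>k. k) h g' ls y))"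
    using s p Cons.prems assms(4) mult_closed[OF p s] by (simp add: eg mult_apply closed)
  then show ?case using Cons eg by simp
qed

text \<open>A single prescribed pair determines a step of either sign: for \<open>e = -1\<close> it
  is read backwards.\<close>

lemma pow_unit_apply:
  assumes "h \<in> K" "e \<in> {1, -1 :: int}" "p \<in> \<Omega>" "q \<in> \<Omega>" "if e = 1 then h q = p else h p = q"
  shows "(h [^]\<^bsub>H\<^esub> e) q = p"
proof (cases "e = 1")
  case True
  then show ?thesis using assms H.int_pow_1[of h] by simp
next
  case False
  then have "h [^]\<^bsub>H\<^esub> e = inv\<^bsub>H\<^esub> h" using assms H.int_pow_neg[of h 1] H.int_pow_1[of h] by simp
  then show ?thesis using assms False inv_apply[of h p] by (simp add: inv_H)
qed

text \<open>The permutation is prescribed along the trajectory only, every newly visited point being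
  fresh; the infinite support of the coefficients leaves room for the choice.\<close>

lemma prescribed_trajectory:
  assumes inf: "infinite \<Omega>"
    and supp: "\<And>g. g \<in> K \<Longrightarrow> g \<noteq> \<one>\<^bsub>BijGroup \<Omega>\<^esub> \<Longrightarrow> infinite {x \<in> \<Omega>. g x \<noteq> x}"
    and "reduced H ls" "finite \<pi>" "\<pi> \<subseteq> \<Omega> \<times> \<Omega>" "inj_on fst \<pi>" "inj_on snd \<pi>" "p \<in> \<Omega>"
    and "ls \<noteq> [] \<Longrightarrow> p \<notin> (if fst (hd ls) = 1 then snd ` \<pi> else fst ` \<pi>)"
    and "finite F"
  shows "\<exists>\<pi>' y. finite \<pi>' \<and> \<pi>' \<subseteq> \<Omega> \<times> \<Omega> \<and> inj_on fst \<pi>' \<and> inj_on snd \<pi>' \<and> \<pi> \<subseteq> \<pi>' \<and> y \<in> \<Omega> \<and>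
    (if ls = [] then y = p else y \<notin> F) \<and> (\<forall>h \<in> K. (\<forall>(a, b) \<in> \<pi>'. h a = b) \<longrightarrow> trajectory h ls y = p)"
  using assms(3-9)
proof (induction ls arbitrary: \<pi> p)
  case Nil
  then show ?case by (intro exI[of _ \<pi>] exI[of _ p]) simp
next
  case (Cons eg ls)
  obtain e g where eg: "eg = (e, g)" by force
  have e: "e \<in> {1, -1}" and g: "g \<in> K" and red: "reduced H ls"
    and sign: "ls \<noteq> [] \<Longrightarrow> g = \<one>\<^bsub>BijGroup \<Omega>\<^esub> \<Longrightarrow> e = fst (hd ls)"
    using Cons.prems(1) eg by (simp_all add: reduced_Cons)
  define B where "B = F \<union> fst ` \<pi> \<union> snd ` \<pi> \<union> {p}"
  have B: "finite B" using Cons.prems(2) \<open>finite F\<close> by (simp add: B_def)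
  \<comment> \<open>Candidates for the point preceding the last coefficient. A nontrivial
    \<open>g\<close> has to move it, so that \<open>r\<close> and \<open>g r\<close> are two
    different fresh points.\<close>
  have "infinite {x \<in> \<Omega>. g = \<one>\<^bsub>BijGroup \<Omega>\<^esub> \<or> g x \<noteq> x}"
    using inf supp[OF g] by (cases "g = \<one>\<^bsub>BijGroup \<Omega>\<^esub>") simp_all
  moreover have "finite (B \<union> (g -` B \<inter> \<Omega>))"
    by (intro finite_UnI B finite_vimage_IntI[OF B inj[OF g]])
  ultimately have "infinite ({x \<in> \<Omega>. g = \<one>\<^bsub>BijGroup \<Omega>\<^esub> \<or> g x \<noteq> x} - (B \<union> (g -` B \<inter> \<Omega>)))"
    by (rule Diff_infinite_finite[rotated])
  from infinite_imp_nonempty[OF this] obtain r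
    where r: "r \<in> \<Omega>" "g = \<one>\<^bsub>BijGroup \<Omega>\<^esub> \<or> g r \<noteq> r" "r \<notin> B" "g r \<notin> B"
    by blast
  have gr: "g r \<in> \<Omega>" using closed[OF g r(1)] .
  \<comment> \<open>The new pair makes the power \<open>e\<close> of \<open>h\<close> send
    \<open>g r\<close> to \<open>p\<close>.\<close>
  define \<pi>1 where "\<pi>1 = insert (if e = 1 then (g r, p) else (p, g r)) \<pi>"
  have head: "p \<notin> (if e = 1 then snd ` \<pi> else fst ` \<pi>)" using Cons.prems(7) eg by simp
  have fresh: "g r \<notin> fst ` \<pi>" "g r \<notin> snd ` \<pi>" "g r \<noteq> p" "r \<notin> fst ` \<pi>" "r \<notin> snd ` \<pi>" "r \<noteq> p" "r \<notin> F"
    using r by (auto simp: B_def)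
  have p1: "finite \<pi>1" "\<pi>1 \<subseteq> \<Omega> \<times> \<Omega>" using Cons.prems(2,3,6) gr by (simp_all add: \<pi>1_def)
  have i1: "inj_on fst \<pi>1" "inj_on snd \<pi>1"
    using Cons.prems(4,5) head fresh
    by (cases "e = 1"; auto simp: \<pi>1_def image_iff split_pairs)+
  \<comment> \<open>The invariant for the next letter. If \<open>g\<close> is trivial,
    \<open>r = g r\<close> does occur in the new pair; but reducedness gives the next letter the
    same sign, and the condition then concerns the other component.\<close>
  have h1: "r \<notin> (if fst (hd ls) = 1 then snd ` \<pi>1 else fst ` \<pi>1)" if "ls \<noteq> []"
  proof (cases "g = \<one>\<^bsub>BijGroup \<Omega>\<^esub>")
    case True
    then show ?thesis using sign[OF that] fresh e r(1) by (auto simp: \<pi>1_def one_apply)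
  next
    case False
    then show ?thesis using r(2) fresh by (auto simp: \<pi>1_def)
  qed
  obtain \<pi>' y where *: "finite \<pi>'" "\<pi>' \<subseteq> \<Omega> \<times> \<Omega>" "inj_on fst \<pi>'" "inj_on snd \<pi>'" "\<pi>1 \<subseteq> \<pi>'" "y \<in> \<Omega>"
    "if ls = [] then y = r else y \<notin> F" "\<forall>h \<in> K. (\<forall>(a, b) \<in> \<pi>'. h a = b) \<longrightarrow> trajectory h ls y = r"
    using Cons.IH[OF red p1 i1 r(1) h1] by blast
  have "y \<notin> F" using *(7) fresh by (auto split: if_splits)
  moreover have "trajectory h (eg # ls) y = p" if h: "h \<in> K" "\<forall>(a, b) \<in> \<pi>'. h a = b" for h
  proof -
    have "if e = 1 then h (g r) = p else h p = g r"
      using h(2) *(5) by (auto simp: \<pi>1_def)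
    then have "(h [^]\<^bsub>H\<^esub> e) (g r) = p"
      using pow_unit_apply[OF h(1) e Cons.prems(6) gr] by simp
    then show ?thesis using *(8) h eg by simp
  qed
  moreover have "\<pi> \<subseteq> \<pi>'" using *(5) by (auto simp: \<pi>1_def)
  ultimately show ?case using * by (intro exI[of _ \<pi>'] exI[of _ y]) simp
qed

text \<open>A normal form without syllables is a constant, and substitution shows that this constant
  is trivial. For any other normal form some \<open>h\<close>, substituted for the free generator,
  makes the word move a point.\<close>

lemma mixed_identity_freeI:
  assumes inf: "infinite \<Omega>"
    and supp: "\<And>g. g \<in> K \<Longrightarrow> g \<noteq> \<one>\<^bsub>BijGroup \<Omega>\<^esub> \<Longrightarrow> infinite {x \<in> \<Omega>. g x \<noteq> x}"
    and trans: "highly_transitive_action H \<Omega> (\<lambda>h. h)"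
  shows "mixed_identity_free H"
proof (rule ccontr)
  let ?P = "free_product H integer_group"
  let ?\<iota> = "fp_inl H integer_group" and ?x = "fp_inr H integer_group 1"
  assume "\<not> mixed_identity_free H"
  then obtain W where W: "is_mixed_identity H W" "W \<noteq> \<one>\<^bsub>?P\<^esub>" by (auto simp: mixed_identity_free_def)
  interpret P: group ?P using H.is_group by (rule group_free_product) simp
  interpret \<iota>: group_hom H ?P ?\<iota>
    by (simp add: group_hom_def group_hom_axioms_def H.is_group P.is_group fp_inl_hom)
  have \<iota>_closed: "?\<iota> \<in> carrier H \<rightarrow> carrier ?P" using fp_inl_hom by (auto simp: hom_def)
  have x_closed: "?x \<in> carrier ?P"
    using fp_inr_hom[of H integer_group] by (auto simp: hom_def)
  have "W \<in> carrier ?P" using W(1) by (simp add: is_mixed_identity_def)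
  then obtain g ls where g: "g \<in> carrier H" and red: "reduced H ls"
    and nf: "W = syllables ?P ?\<iota> ?x g ls"
    using free_product_normal_form[OF H.is_group] by blast
  have gK: "g \<in> K" and ls: "set ls \<subseteq> UNIV \<times> K" using g red by (auto simp: reduced_def)
  \<comment> \<open>By the universal property, every \<open>h\<close> in \<open>K\<close> may be
    substituted for the generator of the integers.\<close>
  have one: "syllables H (\<lambda>k. k) h g ls = \<one>\<^bsub>H\<^esub>" if h: "h \<in> K" for h
  proof -
    have "group_hom H H (\<lambda>k. k)"
      by (simp add: group_hom_def group_hom_axioms_def H.is_group hom_def)
    moreover have "group_hom integer_group H (\<lambda>n. h [^]\<^bsub>H\<^esub> (n :: int))"
      using H.hom_integer_group_pow[of h] h
      by (simp add: group_hom_def group_hom_axioms_def H.is_group)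
    ultimately obtain \<phi> where \<phi>: "\<phi> \<in> hom ?P H" "\<forall>a \<in> carrier H. \<phi> (?\<iota> a) = a"
      "\<forall>b \<in> carrier integer_group. \<phi> (fp_inr H integer_group b) = h [^]\<^bsub>H\<^esub> b"
      using free_product_lift by blast
    interpret \<phi>: group_hom ?P H \<phi>
      by (simp add: group_hom_def group_hom_axioms_def H.is_group P.is_group \<phi>(1))
    have "\<phi> ?x = h" using \<phi>(3) H.int_pow_1[of h] h by simp
    moreover have "syllables H (\<phi> \<circ> ?\<iota>) h g ls = syllables H (\<lambda>k. k) h g ls"
      using gK ls \<phi>(2) by (induction H "\<phi> \<circ> ?\<iota>" h g ls rule: syllables.induct) simp_all
    ultimately have "\<phi> W = syllables H (\<lambda>k. k) h g ls"
      using \<phi>.hom_syllables[OF \<iota>_closed x_closed g] ls by (simp add: nf)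
    moreover have "\<phi> W = \<one>\<^bsub>H\<^esub>" using W(1) \<phi> by (simp add: is_mixed_identity_def)
    ultimately show ?thesis by simp
  qed
  show False
  proof (cases "ls = []")
    case True
    then have "g = \<one>\<^bsub>H\<^esub>" using one[OF one_closed] by simp
    then have "W = \<one>\<^bsub>?P\<^esub>" using nf True \<iota>.hom_one by simp
    then show False using W(2) by simp
  next
    case False
    obtain z where z: "z \<in> \<Omega>" using inf by fastforce
    \<comment> \<open>With this end point of the trajectory, the leading coefficient
      \<open>g\<close> leads to \<open>z\<close>. Passing \<open>{z}\<close> as the forbidden set
      gives a start \<open>y\<close> different from \<open>z\<close>.\<close>
    let ?p = "(inv\<^bsub>BijGroup \<Omega>\<^esub> g) z"
    have p: "?p \<in> \<Omega>" using z inv_closed[OF gK] by (simp add: closed)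
    obtain \<pi> y where \<pi>: "finite \<pi>" "\<pi> \<subseteq> \<Omega> \<times> \<Omega>" "inj_on fst \<pi>" "inj_on snd \<pi>" "y \<in> \<Omega>" "y \<noteq> z"
      "\<And>h. h \<in> K \<Longrightarrow> \<forall>(a, b) \<in> \<pi>. h a = b \<Longrightarrow> trajectory h ls y = ?p"
    proof -
      have "?p \<notin> (if fst (hd ls) = 1 then snd ` {} else fst ` {})" by simp
      from prescribed_trajectory[OF inf supp red _ _ _ _ p this, of "{z}"] that show thesis
        using False by simp blast
    qed
    obtain h where h: "h \<in> K" "\<And>a b. (a, b) \<in> \<pi> \<Longrightarrow> h a = b"
      using extend_finite_injection[OF trans \<pi>(1-4)] by blast
    have "\<forall>(a, b) \<in> \<pi>. h a = b" using h(2) by blast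
    then have "syllables H (\<lambda>k. k) h g ls y = g ?p"
      using syllables_apply[OF h(1) gK ls \<pi>(5)] \<pi>(7)[OF h(1)] by simp
    then show False using one[OF h(1)] \<pi>(5,6) apply_inv[OF gK z] by (simp add: one_apply)
  qed
qed

end

section \<open>Self-similarity and isolation in a sparse set of integers\<close>

section \<open>Integers with digits 0 and 1 in base 4\<close>

inductive_set digits01 :: "int set" where
  zero: "0 \<in> digits01"
| dig0: "n \<in> digits01 \<Longrightarrow> 4 * n \<in> digits01"
| dig1: "n \<in> digits01 \<Longrightarrow> 4 * n + 1 \<in> digits01"

lemma digits01_nonneg: "n \<in> digits01 \<Longrightarrow> 0 \<le> n"
  by (induction rule: digits01.induct) auto

lemma digits01_cases:
  assumes "n \<in> digits01"
  shows "n mod 4 \<in> {0, 1}" "n div 4 \<in> digits01"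
  using assms by (cases rule: digits01.cases; auto intro: digits01.zero)+

lemma digits01_iff: "n \<in> digits01 \<longleftrightarrow> n mod 4 \<in> {0, 1} \<and> n div 4 \<in> digits01"
proof
  assume *: "n mod 4 \<in> {0, 1} \<and> n div 4 \<in> digits01"
  then have "n = 4 * (n div 4) \<or> n = 4 * (n div 4) + 1" by auto presburger+
  then show "n \<in> digits01" using digits01.dig0 digits01.dig1 * by metis
qed (use digits01_cases in blast)

text \<open>The last \<open>k\<close> digits are at most 1 each, so they contribute at most
  \<open>(4^k - 1) / 3\<close>.\<close>

lemma digits01_mod:
  assumes "n \<in> digits01"
  shows "3 * (n mod 4 ^ k) < 4 ^ k"
  using assms
proof (induction k arbitrary: n)
  case (Suc k)
  have "n mod 4 ^ Suc k = 4 * (n div 4 mod 4 ^ k) + n mod 4"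
    using zmod_zmult2_eq[of "4 ^ k" n 4] by simp
  moreover have "n mod 4 \<le> 1" using digits01_cases(1)[OF Suc.prems] by auto
  moreover have "3 * (n div 4 mod 4 ^ k) + 1 \<le> 4 ^ k"
    using Suc.IH[OF digits01_cases(2)[OF Suc.prems]] by simp
  ultimately show ?case by simp
qed simp

text \<open>For nonnegative \<open>n\<close> the digit at position \<open>k\<close> changes from 0
  to 1. For negative \<open>n\<close> the sum lies strictly between two thirds of \<open>4^k\<close>
  and \<open>4^k\<close>, which \<open>digits01_mod\<close> forbids.\<close>

lemma digits01_add_power:
  assumes "3 * \<bar>n\<bar> < 4 ^ k"
  shows "n + 4 ^ k \<in> digits01 \<longleftrightarrow> n \<in> digits01"
proof (cases "n < 0")
  case True
  have "n + 4 ^ k \<notin> digits01"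
  proof
    assume "n + 4 ^ k \<in> digits01"
    moreover have "(n + 4 ^ k) mod 4 ^ k = n + 4 ^ k"
      using True assms by (intro mod_pos_pos_trivial) auto
    ultimately have "3 * (n + 4 ^ k) < 4 ^ k" using digits01_mod[of "n + 4 ^ k" k] by metis
    moreover have "(0 :: int) < 4 ^ k" by simp
    moreover have "- (3 * n) < 4 ^ k" using True assms by simp
    ultimately show False unfolding distrib_left by linarith
  qed
  then show ?thesis using True digits01_nonneg by fastforce
next
  case False
  then have "0 \<le> n" "n < 4 ^ k" using assms by auto
  then show ?thesis
  proof (induction k arbitrary: n)
    case 0
    then have "n = 0" by simp
    then show ?case using digits01.zero digits01.dig1[OF digits01.zero] by simp
  next
    case (Suc k)
    have "n div 4 + 4 ^ k \<in> digits01 \<longleftrightarrow> n div 4 \<in> digits01"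
      using Suc.prems by (intro Suc.IH) auto
    moreover have "(n + 4 ^ Suc k) mod 4 = n mod 4" "(n + 4 ^ Suc k) div 4 = n div 4 + 4 ^ k"
      by auto
    ultimately show ?case using digits01_iff by metis
  qed
qed

text \<open>Divisibility by 4 keeps the points \<open>s\<close>, \<open>s + 1\<close>,
  \<open>s + 2\<close> belonging to different members \<open>s\<close> apart.\<close>

definition sparse_set :: "int set" where
  "sparse_set = {n \<in> digits01. 4 dvd n}"

lemma zero_in_sparse_set: "0 \<in> sparse_set"
  by (simp add: sparse_set_def digits01.zero)

lemma sparse_set_dvd: "n \<in> sparse_set \<Longrightarrow> 4 dvd n"
  by (simp add: sparse_set_def)

lemma sparse_set_nonneg: "n \<in> sparse_set \<Longrightarrow> 0 \<le> n"
  by (simp add: sparse_set_def digits01_nonneg)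

lemma sparse_set_mod: "n \<in> sparse_set \<Longrightarrow> 3 * (n mod 4 ^ k) < 4 ^ k"
  by (simp add: sparse_set_def digits01_mod)

lemma eventually_less_power4: "eventually (\<lambda>k. (c :: int) < 4 ^ k) sequentially"
proof (rule eventually_sequentiallyI)
  fix k assume k: "nat c \<le> k"
  have "k < 4 ^ k" by (induction k) auto
  then have "int k < 4 ^ k" by (metis of_nat_less_iff of_nat_numeral of_nat_power)
  then show "c < 4 ^ k" using k by linarith
qed

lemma sparse_set_recurrent: "eventually (\<lambda>k. n + 4 ^ k \<in> sparse_set \<longleftrightarrow> n \<in> sparse_set) sequentially"
  using eventually_less_power4[of "3 * \<bar>n\<bar>"] eventually_gt_at_top[of 0]
proof eventually_elim
  case (elim k)
  have "(4 :: int) dvd 4 ^ k" using elim(2) by simp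
  then show ?case using digits01_add_power[OF elim(1)] by (simp add: sparse_set_def dvd_add_left_iff)
qed

text \<open>The shift is by the number whose digits are all 1, so that adding any nonzero element of
  the set below the next power of 4 produces a digit 2.\<close>

lemma sparse_set_isolated:
  obtains m where "m \<in> sparse_set" "\<And>s. s \<in> sparse_set \<Longrightarrow> s + m \<in> sparse_set \<Longrightarrow> s \<le> c \<Longrightarrow> s = 0"
proof -
  define rep where "rep = rec_nat (0 :: int) (\<lambda>_ x. 4 * x + 1)"
  have rep: "rep 0 = 0" "rep (Suc k) = 4 * rep k + 1" for k by (simp_all add: rep_def)
  have rep_in: "rep k \<in> digits01" for k
    by (induction k) (simp_all add: rep digits01.zero digits01.dig1)
  have iso: "d = 0" if "d \<in> digits01" "d + rep k \<in> digits01" "d < 4 ^ k" for d k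
    using that
  proof (induction k arbitrary: d)
    case 0
    then show ?case using digits01_nonneg[of d] by simp
  next
    case (Suc k)
    from \<open>d \<in> digits01\<close> show ?case
    proof cases
      case (dig0 n)
      have "n + rep k \<in> digits01"
      proof -
        have "(d + rep (Suc k)) div 4 = n + rep k" using dig0 by (simp add: rep)
        then show ?thesis using digits01_cases(2)[OF Suc.prems(2)] by simp
      qed
      then show ?thesis using Suc.IH[of n] Suc.prems dig0 by simp
    next
      case (dig1 n)
      have "(d + rep (Suc k)) mod 4 = 2" using dig1 by (simp add: rep; presburger)
      then show ?thesis using digits01_cases(1)[OF Suc.prems(2)] by simp
    qed
  qed
  obtain k where k: "c < 4 ^ k"
    using eventually_happens'[OF sequentially_bot eventually_less_power4] by blast
  show thesis
  proof (rule that)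
    show "4 * rep k \<in> sparse_set" by (simp add: sparse_set_def digits01.dig0 rep_in)
    fix s assume s: "s \<in> sparse_set" "s + 4 * rep k \<in> sparse_set" "s \<le> c"
    then obtain d where d: "s = 4 * d" using sparse_set_dvd by (auto elim: dvdE)
    have "d \<in> digits01" "d + rep k \<in> digits01"
      using s d digits01_cases(2)[of s] digits01_cases(2)[of "s + 4 * rep k"]
      by (auto simp: sparse_set_def)
    moreover have "d < 4 ^ k" using s k d sparse_set_nonneg[OF s(1)] by simp
    ultimately show "s = 0" using iso d by simp
  qed
qed

section \<open>Translations and sparse products of transpositions\<close>

section \<open>The permutation group\<close>

locale shift_extension = group G for G :: "('a, 'b) monoid_scheme" (structure) +
  fixes Sg :: "'a set"
  assumes finite_Sg: "finite Sg" and Sg_closed: "Sg \<subseteq> carrier G" and generate_Sg: "generate G Sg = carrier G"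
begin

abbreviation L where "L \<equiv> G \<times>\<times> integer_group"
abbreviation \<Omega> where "\<Omega> \<equiv> carrier L"
abbreviation T where "T \<equiv> left_regular L"

sublocale L: group L
  by (intro DirProd_group is_group) simp

lemma T_apply: "y \<in> carrier G \<Longrightarrow> T (g, i) (y, n) = (g \<otimes> y, i + n)"
  by (simp add: left_regular_def)

lemma T_apply': "x \<in> \<Omega> \<Longrightarrow> T g x = g \<otimes>\<^bsub>L\<^esub> x"
  by (simp add: left_regular_def)

lemma T_Bij:
  assumes g: "g \<in> \<Omega>"
  shows "T g \<in> Bij \<Omega>"
proof -
  have "bij_betw (T g) \<Omega> \<Omega>"
  proof (rule bij_betw_byWitness[where f' = "T (inv\<^bsub>L\<^esub> g)"])
    show "\<forall>x \<in> \<Omega>. T (inv\<^bsub>L\<^esub> g) (T g x) = x"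
      using g by (simp add: T_apply' L.inv_closed L.m_closed del: carrier_DirProd one_DirProd flip: L.m_assoc)
    show "\<forall>x \<in> \<Omega>. T g (T (inv\<^bsub>L\<^esub> g) x) = x"
      using g by (simp add: T_apply' L.inv_closed L.m_closed del: carrier_DirProd one_DirProd flip: L.m_assoc)
    show "T g ` \<Omega> \<subseteq> \<Omega>" "T (inv\<^bsub>L\<^esub> g) ` \<Omega> \<subseteq> \<Omega>"
      using g L.m_closed L.inv_closed by (auto simp: T_apply' simp del: carrier_DirProd)
  qed
  then show ?thesis by (simp add: Bij_def left_regular_def)
qed

lemma T_hom: "T \<in> hom L (BijGroup \<Omega>)"
proof (rule homI)
  fix g h assume gh: "g \<in> \<Omega>" "h \<in> \<Omega>"
  have "T (g \<otimes>\<^bsub>L\<^esub> h) x = compose \<Omega> (T g) (T h) x" for x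
    using gh L.m_closed L.m_assoc
    by (cases "x \<in> \<Omega>") (simp_all add: T_apply' compose_def left_regular_def del: carrier_DirProd)
  then have "T (g \<otimes>\<^bsub>L\<^esub> h) = compose \<Omega> (T g) (T h)" by (rule ext)
  then show "T (g \<otimes>\<^bsub>L\<^esub> h) = T g \<otimes>\<^bsub>BijGroup \<Omega>\<^esub> T h"
    using T_Bij[OF gh(1)] T_Bij[OF gh(2)] by (simp add: BijGroup_def)
qed (simp add: BijGroup_def T_Bij del: carrier_DirProd)

text \<open>The second coordinate 1 makes every element admissible for a swap, since 4 does not
  divide it.\<close>

definition U :: "('a \<times> int) set" where
  "U = insert \<one> Sg \<times> {1}"

lemma U_closed: "U \<subseteq> \<Omega>"
  using Sg_closed by (auto simp: U_def)

text \<open>The element \<open>(\<one>, 1)\<close> yields the factor of integers, and multiplying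
  \<open>(g, 1)\<close> by its inverse yields \<open>(g, 0)\<close>.\<close>

lemma generate_U: "generate L U = \<Omega>"
proof
  show "generate L U \<subseteq> \<Omega>" using L.generate_incl[OF U_closed] .
  have sg: "subgroup (generate L U) L" using L.generate_is_subgroup[OF U_closed] .
  have inv_pair: "inv\<^bsub>L\<^esub> (g, n) = (inv g, - n)" if "g \<in> carrier G" for g and n :: int
    using inv_DirProd[OF is_group group_integer_group that, of n] by simp
  have one: "(\<one>, 1) \<in> generate L U" by (rule generate.incl) (simp add: U_def)
  then have minus_one: "(\<one>, -1) \<in> generate L U" using subgroup.m_inv_closed[OF sg one] inv_pair by simp
  have Z: "(\<one>, n) \<in> generate L U" for n
  proof (induction n rule: int_induct[where k = 0])
    case base
    then show ?case using subgroup.one_closed[OF sg] by simp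
  next
    case (step1 i)
    then show ?case using subgroup.m_closed[OF sg step1(2) one] by simp
  next
    case (step2 i)
    then show ?case using subgroup.m_closed[OF sg step2(2) minus_one] by simp
  qed
  have "(g, 0) \<in> generate L U" if "g \<in> generate G Sg" for g
    using that
  proof induction
    case one
    show ?case by (rule Z)
  next
    case (incl g)
    then have "(g, 1) \<in> generate L U" by (intro generate.incl) (simp add: U_def)
    from subgroup.m_closed[OF sg this minus_one] show ?case using incl Sg_closed by auto
  next
    case (inv g)
    then have "(g, 1) \<in> generate L U" by (intro generate.incl) (simp add: U_def)
    from subgroup.m_closed[OF sg this minus_one] have "(g, 0) \<in> generate L U" using inv Sg_closed by auto
    from subgroup.m_inv_closed[OF sg this] show ?case
      using inv Sg_closed inv_pair by auto
  next
    case (eng g h)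
    then show ?case using subgroup.m_closed[OF sg eng.IH] by simp
  qed
  then have "(g, n) \<in> generate L U" if "g \<in> carrier G" for g n
    using subgroup.m_closed[OF sg _ Z, of "(g, 0)" n] that generate_Sg by simp
  then show "\<Omega> \<subseteq> generate L U" by auto
qed

text \<open>The product of the transpositions exchanging \<open>(\<one>, n)\<close> and \<open>(\<one>, n) \<otimes> u\<close>, where \<open>n\<close> runs
  through the sparse set translated by \<open>j\<close>.\<close>

definition swap :: "int \<Rightarrow> 'a \<times> int \<Rightarrow> 'a \<times> int \<Rightarrow> 'a \<times> int" where
  "swap j u = (\<lambda>(y, n) \<in> \<Omega>.
     if y = \<one> \<and> n - j \<in> sparse_set then (fst u, n + snd u)
     else if y = fst u \<and> n - snd u - j \<in> sparse_set then (\<one>, n - snd u)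
     else (y, n))"

text \<open>Members of the sparse set differ by multiples of 4. Hence the points
  \<open>(\<one>, n)\<close> and \<open>(\<one>, n) \<otimes> u\<close> of a swap stay disjoint even
  if \<open>fst u = \<one>\<close>, and the swap is an involution.\<close>

definition admissible :: "'a \<times> int \<Rightarrow> bool" where
  "admissible u \<longleftrightarrow> fst u \<in> carrier G \<and> \<not> 4 dvd snd u"

lemma swap_base: "n - j \<in> sparse_set \<Longrightarrow> swap j (g, i) (\<one>, n) = (g, n + i)"
  by (simp add: swap_def)

lemma swap_target:
  assumes "n - j \<in> sparse_set" "admissible (g, i)"
  shows "swap j (g, i) (g, n + i) = (\<one>, n)"
proof -
  have "n + i - j \<notin> sparse_set"
  proof
    assume "n + i - j \<in> sparse_set"
    from dvd_diff[OF sparse_set_dvd[OF this] sparse_set_dvd[OF assms(1)]]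
    show False using assms(2) by (simp add: admissible_def)
  qed
  then show ?thesis using assms by (simp add: swap_def admissible_def)
qed

lemma swap_other:
  "y \<in> carrier G \<Longrightarrow> \<not> (y = \<one> \<and> n - j \<in> sparse_set) \<Longrightarrow> \<not> (y = g \<and> n - i - j \<in> sparse_set) \<Longrightarrow>
    swap j (g, i) (y, n) = (y, n)"
  by (auto simp: swap_def)

lemma swap_cases:
  assumes "x \<in> \<Omega>"
  obtains (base) n where "n - j \<in> sparse_set" "x = (\<one>, n)" "swap j (g, i) x = (g, n + i)"
  | (target) n where "n - j \<in> sparse_set" "x = (g, n + i)" "swap j (g, i) x = (\<one>, n)"
  | (other) "swap j (g, i) x = x"
proof -
  obtain y n where x: "x = (y, n)" "y \<in> carrier G" using assms by auto
  consider "y = \<one> \<and> n - j \<in> sparse_set" | "\<not> (y = \<one> \<and> n - j \<in> sparse_set)" "y = g" "n - i - j \<in> sparse_set"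
    | "swap j (g, i) x = x" using swap_other x by blast
  then show thesis
  proof cases
    case 2
    then have "swap j (g, i) x = (\<one>, n - i)" using x by (auto simp: swap_def)
    then show thesis using target[of "n - i"] 2 x by simp
  qed (use base x swap_base other in auto)
qed

lemma swap_closed:
  assumes "admissible u" "x \<in> \<Omega>"
  shows "swap j u x \<in> \<Omega>"
proof -
  obtain g i where "u = (g, i)" by force
  then show ?thesis using assms by (cases rule: swap_cases[OF assms(2), of j g i]) (auto simp: admissible_def)
qed

lemma swap_swap:
  assumes "admissible u" "x \<in> \<Omega>"
  shows "swap j u (swap j u x) = x"
proof -
  obtain g i where u: "u = (g, i)" by force
  show ?thesis
    using assms(1) swap_base[of _ j g i] swap_target[of _ j g i] unfolding u
    by (cases rule: swap_cases[OF assms(2), of j g i]) simp_all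
qed

lemma swap_Bij:
  assumes "admissible u"
  shows "swap j u \<in> Bij \<Omega>"
proof -
  have "bij_betw (swap j u) \<Omega> \<Omega>"
    using swap_closed[OF assms] swap_swap[OF assms]
    by (intro bij_betw_byWitness[where f' = "swap j u"]) (auto simp del: carrier_DirProd)
  then show ?thesis by (simp add: Bij_def swap_def)
qed

text \<open>The extra element supplies the second factor of the commutators. Its shift 2 and the
  shift 1 of \<open>U\<close> differ modulo 4, which keeps the targets of the two kinds of swaps
  apart.\<close>

definition V :: "('a \<times> int) set" where
  "V = insert (\<one>, 2) U"

lemma V_admissible: "u \<in> V \<Longrightarrow> admissible u"
  using Sg_closed by (auto simp: V_def U_def admissible_def)

definition generators :: "('a \<times> int \<Rightarrow> 'a \<times> int) set" where
  "generators = T ` U \<union> swap 0 ` V"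

definition K :: "('a \<times> int \<Rightarrow> 'a \<times> int) set" where
  "K = generate (BijGroup \<Omega>) generators"

lemma generators_Bij: "generators \<subseteq> carrier (BijGroup \<Omega>)"
  using T_Bij U_closed swap_Bij V_admissible
  by (auto simp: generators_def BijGroup_def simp del: carrier_DirProd)

lemma finite_generators: "finite generators"
  by (simp add: generators_def V_def U_def finite_Sg)

sublocale perm_group \<Omega> K
  unfolding K_def by (intro perm_group.intro group.generate_is_subgroup group_BijGroup generators_Bij)

lemma generators_K: "generators \<subseteq> K"
  by (auto simp: K_def intro: generate.incl)

lemma T_K: "g \<in> \<Omega> \<Longrightarrow> T g \<in> K"
proof -
  interpret T: group_hom L "BijGroup \<Omega>" T
    using T_hom group_BijGroup by (simp add: group_hom_def group_hom_axioms_def L.is_group)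
  assume "g \<in> \<Omega>"
  then have "T g \<in> generate (BijGroup \<Omega>) (T ` U)"
    using T.generate_img[OF U_closed] generate_U by blast
  then show ?thesis
    unfolding K_def generators_def using group.mono_generate[OF group_BijGroup] by blast
qed

text \<open>\<open>swap j u\<close> is the conjugate of the generator \<open>swap 0 u\<close> by the
  translation \<open>T (\<one>, j)\<close>.\<close>

lemma swap_K:
  assumes "u \<in> V"
  shows "swap j u \<in> K"
proof -
  have u: "admissible u" using V_admissible[OF assms] .
  have k: "swap 0 u \<in> K" using generators_K assms by (auto simp: generators_def)
  have t: "T (\<one>, i) \<in> K" for i by (rule T_K) simp
  let ?h = "T (\<one>, j) \<otimes>\<^bsub>BijGroup \<Omega>\<^esub> (swap 0 u \<otimes>\<^bsub>BijGroup \<Omega>\<^esub> T (\<one>, - j))"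
  have h: "?h \<in> K" using k t mult_closed by blast
  have "?h x = swap j u x" if "x \<in> \<Omega>" for x
  proof -
    obtain y n where x: "x = (y, n)" "y \<in> carrier G" using \<open>x \<in> \<Omega>\<close> by auto
    have "?h x = T (\<one>, j) (swap 0 u (T (\<one>, - j) x))"
      using that k t mult_closed[OF k t] by (simp add: mult_apply closed del: carrier_DirProd)
    also have "\<dots> = swap j u x"
      using x u by (auto simp: T_apply swap_def admissible_def algebra_simps)
    finally show ?thesis .
  qed
  then have "?h = swap j u"
    by (rule extensionalityI[OF Bij_imp_extensional[OF Bij[OF h]] Bij_imp_extensional[OF swap_Bij[OF u]]])
  then show ?thesis using h by simp
qed

lemma finitely_generated_H: "finitely_generated H"
proof -
  have "generate H generators = K"
    using group.generate_consistent[OF group_BijGroup generators_K subgroup_BijGroup] by (simp add: K_def)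
  then show ?thesis
    unfolding finitely_generated_def using finite_generators generators_K by (intro exI[of _ generators]) simp
qed


section \<open>Three-cycles on finite windows and moves that fix a finite set\<close>

subsection \<open>High transitivity\<close>

text \<open>Two involutions whose supports share a single point have a 3-cycle as commutator. Here
  the supports of \<open>a\<close> and \<open>b\<close> share only \<open>(\<one>, 0)\<close> within
  the window \<open>R\<close>, and the cycle is \<open>(\<one>, 0)\<close> to \<open>(g, 1)\<close>
  to \<open>(\<one>, 2)\<close>.\<close>

lemma isolated_three_cycle:
  assumes "(g, 1) \<in> U" "finite R"
  obtains c where "c \<in> K" "c (\<one>, 0) = (g, 1)"
    "\<And>x. x \<in> R \<inter> \<Omega> - {(\<one>, 0), (g, 1), (\<one>, 2)} \<Longrightarrow> c x = x"
proof -
  have g: "g \<in> carrier G" using assms(1) U_closed by auto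
  have adm: "admissible (g, 1)" "admissible (\<one>, 2)" using g by (simp_all add: admissible_def)
  \<comment> \<open>Inserting 0 keeps the set nonempty, so that \<open>Max\<close> is meaningful
    when \<open>R\<close> is empty.\<close>
  define B where "B = Max (insert 0 (snd ` R))"
  have B: "snd x \<le> B" if "x \<in> R" for x using that assms(2) by (simp add: B_def)
  obtain m where m: "m \<in> sparse_set"
    "\<And>s. s \<in> sparse_set \<Longrightarrow> s + m \<in> sparse_set \<Longrightarrow> s \<le> B \<Longrightarrow> s = 0"
    using sparse_set_isolated by blast
  have m4: "4 dvd m" using m(1) by (rule sparse_set_dvd)
  define a where "a = swap 0 (g, 1)"
  define b where "b = swap (- m) (\<one>, 2)"
  have abK: "a \<in> K" "b \<in> K" using assms(1) by (auto simp: a_def b_def V_def intro!: swap_K)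
  have a1: "a (\<one>, n) = (g, n + 1)" and a2: "a (g, n + 1) = (\<one>, n)" if "n \<in> sparse_set" for n
    using swap_base[of n 0 g 1] swap_target[of n 0 g 1] adm that by (simp_all add: a_def)
  have a3: "a (y, n) = (y, n)"
    if "y \<in> carrier G" "\<not> (y = \<one> \<and> n \<in> sparse_set)" "\<not> (y = g \<and> n - 1 \<in> sparse_set)" for y n
    using swap_other[of y n 0 g 1] that by (simp add: a_def)
  have b1: "b (\<one>, n) = (\<one>, n + 2)" and b2: "b (\<one>, n + 2) = (\<one>, n)" if "n + m \<in> sparse_set" for n
    using swap_base[of n "- m" \<one> 2] swap_target[of n "- m" \<one> 2] adm that by (simp_all add: b_def)
  have b3: "b (y, n) = (y, n)"
    if "y \<in> carrier G" "\<not> (y = \<one> \<and> n + m \<in> sparse_set)" "\<not> (y = \<one> \<and> n - 2 + m \<in> sparse_set)" for y n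
    using swap_other[of y n "- m" \<one> 2] that by (simp add: b_def)
  have P4: "4 dvd n" if "n \<in> sparse_set" for n using that by (rule sparse_set_dvd)
  have Q4: "4 dvd n" if "n + m \<in> sparse_set" for n
    using sparse_set_dvd[OF that] m4 by (simp add: dvd_add_left_iff)
  define c where "c = a \<otimes>\<^bsub>BijGroup \<Omega>\<^esub> (b \<otimes>\<^bsub>BijGroup \<Omega>\<^esub> (a \<otimes>\<^bsub>BijGroup \<Omega>\<^esub> b))"
  have cK: "c \<in> K" using abK mult_closed by (simp add: c_def del: carrier_DirProd)
  have c: "c x = a (b (a (b x)))" if "x \<in> \<Omega>" for x
    using that abK mult_closed closed by (simp add: c_def mult_apply del: carrier_DirProd)
  show thesis
  proof (rule that[OF cK])
    have "b (\<one>, 0) = (\<one>, 2)" "b (\<one>, 2) = (\<one>, 0)" using b1[of 0] b2[of 0] m(1) by simp_all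
    moreover have "a (\<one>, 2) = (\<one>, 2)" using P4[of 2] P4[of 1] by (intro a3) auto
    moreover have "a (\<one>, 0) = (g, 1)" using a1[OF zero_in_sparse_set] by simp
    ultimately show "c (\<one>, 0) = (g, 1)" by (simp add: c)
    fix x assume "x \<in> R \<inter> \<Omega> - {(\<one>, 0), (g, 1), (\<one>, 2)}"
    then obtain y n where x: "x = (y, n)" "y \<in> carrier G" "(y, n) \<in> R" "(y, n) \<noteq> (\<one>, 0)" "(y, n) \<noteq> (g, 1)"
      "(y, n) \<noteq> (\<one>, 2)" by auto
    have n: "n \<le> B" using B[OF x(3)] by simp
    have no_common: "s = 0" if "s \<in> sparse_set" "s + m \<in> sparse_set" "s \<le> n" for s
      using m(2)[of s] that n by simp
    \<comment> \<open>The point is a base or a target of \<open>a\<close>, or of \<open>b\<close>,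
      or is fixed by both. Residues modulo 4 and \<open>no_common\<close> show that the other
      involution fixes the point and its partner, so the involution that moves it acts twice and
      cancels.\<close>
    consider (A1) "y = \<one>" "n \<in> sparse_set" | (A2) "y = g" "n - 1 \<in> sparse_set"
      | (B1) "y = \<one>" "n + m \<in> sparse_set" | (B2) "y = \<one>" "n - 2 + m \<in> sparse_set"
      | (none) "\<not> (y = \<one> \<and> n \<in> sparse_set)" "\<not> (y = g \<and> n - 1 \<in> sparse_set)"
          "\<not> (y = \<one> \<and> n + m \<in> sparse_set)" "\<not> (y = \<one> \<and> n - 2 + m \<in> sparse_set)" by blast
    then have "a (b (a (b (y, n)))) = (y, n)"
    proof cases
      case A1
      have "n + m \<notin> sparse_set" using no_common[of n] A1 x by auto
      moreover have "\<not> 4 dvd n - 2" "\<not> 4 dvd n + 1" "\<not> 4 dvd n + 1 - 2" using P4[OF A1(2)] by presburger+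
      ultimately have "b (y, n) = (y, n)" "b (g, n + 1) = (g, n + 1)"
        using Q4 x g A1 by (auto intro!: b3)
      then show ?thesis using a1[OF A1(2)] a2[OF A1(2)] A1 by simp
    next
      case A2
      have "n - 1 + m \<notin> sparse_set" using no_common[of "n - 1"] A2 x by auto
      moreover have "\<not> 4 dvd n" "\<not> 4 dvd n - 2" "\<not> 4 dvd n - 1 - 2" using P4[OF A2(2)] by presburger+
      ultimately have "b (y, n) = (y, n)" "b (\<one>, n - 1) = (\<one>, n - 1)"
        using Q4 x g A2 by (auto intro!: b3)
      then show ?thesis using a1[OF A2(2)] a2[OF A2(2)] A2 by simp
    next
      case B1
      have "n \<notin> sparse_set" using no_common[of n] B1 x by auto
      moreover have "\<not> 4 dvd n - 1" "\<not> 4 dvd n + 2" "\<not> 4 dvd n + 2 - 1" using Q4[OF B1(2)] by presburger+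
      ultimately have "a (y, n) = (y, n)" "a (\<one>, n + 2) = (\<one>, n + 2)"
        using P4 x g B1 by (auto intro!: a3)
      then show ?thesis using b1[OF B1(2)] b2[OF B1(2)] B1 by simp
    next
      case B2
      have "n - 2 \<notin> sparse_set" using no_common[of "n - 2"] B2 x by auto
      moreover have "\<not> 4 dvd n" "\<not> 4 dvd n - 1" "\<not> 4 dvd n - 2 - 1" using Q4[OF B2(2)] by presburger+
      ultimately have "a (y, n) = (y, n)" "a (\<one>, n - 2) = (\<one>, n - 2)"
        using P4 x g B2 by (auto intro!: a3)
      then show ?thesis using b1[OF B2(2)] b2[OF B2(2)] B2 by simp
    next
      case none
      then show ?thesis using a3 b3 x by simp
    qed
    then show "c x = x" using c x by simp
  qed
qed

text \<open>The moves required by \<open>highly_transitive_actionI\<close>, as a relation. It is an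
  equivalence relation on \<open>\<Omega>\<close> invariant under translations, so linking the
  identity to the generators in \<open>U\<close> is enough.\<close>

definition linked :: "'a \<times> int \<Rightarrow> 'a \<times> int \<Rightarrow> bool" where
  "linked x y \<longleftrightarrow> x \<in> \<Omega> \<and> y \<in> \<Omega> \<and>
     (\<forall>R. finite R \<longrightarrow> x \<notin> R \<longrightarrow> y \<notin> R \<longrightarrow> (\<exists>h \<in> K. h x = y \<and> (\<forall>r \<in> R \<inter> \<Omega>. h r = r)))"

lemma finite_preimage: "h \<in> K \<Longrightarrow> finite R \<Longrightarrow> finite {x \<in> \<Omega>. h x \<in> R}"
  using finite_vimage_IntI[OF _ inj, of R h] by (simp add: vimage_def Int_def conj_commute)

text \<open>The commutator moves \<open>(\<one>, 2)\<close> as well. If this point lies in \<open>R\<close>, conjugation by an element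
  that fixes \<open>(\<one>, 0)\<close> and \<open>(g, 1)\<close> brings it to some \<open>(\<one>, 2 * m)\<close> outside \<open>R\<close>.\<close>

lemma linked_U:
  assumes "u \<in> U"
  shows "linked (\<one>, 0) u"
  unfolding linked_def
proof (intro conjI allI impI)
  obtain g where u: "u = (g, 1)" "g \<in> carrier G" using assms Sg_closed by (auto simp: U_def)
  show "(\<one>, 0) \<in> \<Omega>" "u \<in> \<Omega>" using u by simp_all
  fix R assume R: "finite R" "(\<one>, 0) \<notin> R" "u \<notin> R"
  have move: "\<exists>k \<in> K. k (\<one>, 0) = (\<one>, 0) \<and> k u = u \<and> k (\<one>, 2) = (\<one>, 2 * int (Suc m))" for m
  proof (induction m)
    case 0
    then show ?case using one_closed u one_apply[of "(\<one>, 0)"] one_apply[of u] one_apply[of "(\<one>, 2)"]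
      by (intro bexI[of _ "\<one>\<^bsub>BijGroup \<Omega>\<^esub>"]) simp_all
  next
    case (Suc m)
    then obtain k where k: "k \<in> K" "k (\<one>, 0) = (\<one>, 0)" "k u = u" "k (\<one>, 2) = (\<one>, 2 * int (Suc m))" by blast
    \<comment> \<open>The sparse set starts at 0, so this translated swap moves no point with second
      coordinate below \<open>2 * int (Suc m)\<close>; it carries the current image of
      \<open>(\<one>, 2)\<close> two steps further.\<close>
    let ?s = "swap (2 * int (Suc m)) (\<one>, 2)"
    have s: "?s \<in> K" by (rule swap_K) (simp add: V_def)
    have neg: "n \<notin> sparse_set" if "n < 0" for n using sparse_set_nonneg that by force
    have "?s (\<one>, 0) = (\<one>, 0)" "?s u = u"
      using u by (auto intro!: swap_other simp: neg)
    moreover have "?s (\<one>, 2 * int (Suc m)) = (\<one>, 2 * int (Suc (Suc m)))"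
      using swap_base[of "2 * int (Suc m)" "2 * int (Suc m)" \<one> 2] zero_in_sparse_set by simp
    ultimately show ?case
      using k u mult_apply[OF s k(1), of "(\<one>, 0)"] mult_apply[OF s k(1), of u] mult_apply[OF s k(1), of "(\<one>, 2)"]
      by (intro bexI[OF _ mult_closed[OF s k(1)]]) simp
  qed
  have "infinite (range (\<lambda>m. (\<one>, 2 * int (Suc m))))"
    by (rule range_inj_infinite) (simp add: inj_def)
  then have "\<not> range (\<lambda>m. (\<one>, 2 * int (Suc m))) \<subseteq> R" using R(1) finite_subset by blast
  then obtain m where m: "(\<one>, 2 * int (Suc m)) \<notin> R" by blast
  obtain k where k: "k \<in> K" "k (\<one>, 0) = (\<one>, 0)" "k u = u" "k (\<one>, 2) = (\<one>, 2 * int (Suc m))"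
    using move by blast
  obtain c where c: "c \<in> K" "c (\<one>, 0) = (g, 1)"
    "\<And>x. x \<in> {x \<in> \<Omega>. k x \<in> R} \<inter> \<Omega> - {(\<one>, 0), (g, 1), (\<one>, 2)} \<Longrightarrow> c x = x"
    using isolated_three_cycle[OF _ finite_preimage[OF k(1) R(1)], of g] assms u by blast
  let ?k' = "inv\<^bsub>BijGroup \<Omega>\<^esub> k"
  have k': "?k' \<in> K" using inv_closed[OF k(1)] .
  have h: "(k \<otimes>\<^bsub>BijGroup \<Omega>\<^esub> (c \<otimes>\<^bsub>BijGroup \<Omega>\<^esub> ?k')) x = k (c (?k' x))" if "x \<in> \<Omega>" for x
    using that k(1) c(1) k' mult_closed closed by (simp add: mult_apply del: carrier_DirProd)
  show "\<exists>h \<in> K. h (\<one>, 0) = u \<and> (\<forall>r \<in> R \<inter> \<Omega>. h r = r)"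
  proof (intro bexI[of _ "k \<otimes>\<^bsub>BijGroup \<Omega>\<^esub> (c \<otimes>\<^bsub>BijGroup \<Omega>\<^esub> ?k')"] conjI ballI)
    have "?k' (\<one>, 0) = (\<one>, 0)" using inv_apply[OF k(1), of "(\<one>, 0)"] k(2) by simp
    then show "(k \<otimes>\<^bsub>BijGroup \<Omega>\<^esub> (c \<otimes>\<^bsub>BijGroup \<Omega>\<^esub> ?k')) (\<one>, 0) = u" using h c(2) k(3) u by simp
    show "k \<otimes>\<^bsub>BijGroup \<Omega>\<^esub> (c \<otimes>\<^bsub>BijGroup \<Omega>\<^esub> ?k') \<in> K" using k(1) c(1) k' mult_closed by blast
    fix r assume r: "r \<in> R \<inter> \<Omega>"
    have z: "?k' r \<in> \<Omega>" "k (?k' r) = r" using r closed[OF k'] apply_inv[OF k(1)] by blast+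
    \<comment> \<open>The three points not controlled by \<open>c\<close> are carried by
      \<open>k\<close> to points outside \<open>R\<close>.\<close>
    then have "?k' r \<noteq> (\<one>, 0)" "?k' r \<noteq> (g, 1)" "?k' r \<noteq> (\<one>, 2)" using r R(2,3) m k(2-4) u by auto
    then have "c (?k' r) = ?k' r" using z r by (intro c(3)) simp
    then show "(k \<otimes>\<^bsub>BijGroup \<Omega>\<^esub> (c \<otimes>\<^bsub>BijGroup \<Omega>\<^esub> ?k')) r = r" using h r z by simp
  qed
qed

lemma linked_refl: "x \<in> \<Omega> \<Longrightarrow> linked x x"
  unfolding linked_def using one_closed one_apply by blast

lemma linked_sym:
  assumes "linked x y"
  shows "linked y x"
  unfolding linked_def
proof (intro conjI allI impI)
  have xy: "x \<in> \<Omega>" "y \<in> \<Omega>" using assms by (simp_all add: linked_def)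
  then show "y \<in> \<Omega>" "x \<in> \<Omega>" by blast+
  fix R :: "('a \<times> int) set" assume "finite R" "y \<notin> R" "x \<notin> R"
  then obtain h where h: "h \<in> K" "h x = y" "\<forall>r \<in> R \<inter> \<Omega>. h r = r" using assms unfolding linked_def by blast
  have "(inv\<^bsub>BijGroup \<Omega>\<^esub> h) y = x" using inv_apply[OF h(1) xy(1)] h(2) by simp
  moreover have "(inv\<^bsub>BijGroup \<Omega>\<^esub> h) r = r" if "r \<in> R \<inter> \<Omega>" for r
    using inv_apply[OF h(1), of r] h(3) that by simp
  ultimately show "\<exists>h \<in> K. h y = x \<and> (\<forall>r \<in> R \<inter> \<Omega>. h r = r)" using inv_closed[OF h(1)] by blast
qed

text \<open>If \<open>y\<close> lies in \<open>R\<close>, take \<open>k\<close> moving \<open>y\<close> to \<open>z\<close> and fixing \<open>x\<close> and the rest of \<open>R\<close>, and \<open>h\<close>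
  moving \<open>x\<close> to \<open>y\<close> and fixing the preimage of \<open>R\<close> under \<open>k\<close>; then conjugate \<open>h\<close> by \<open>k\<close>.\<close>

lemma linked_trans:
  assumes "linked x y" "linked y z"
  shows "linked x z"
proof (cases "x = y \<or> y = z \<or> x = z")
  case True
  then show ?thesis using assms linked_refl by (auto simp: linked_def)
next
  case distinct: False
  show ?thesis
    unfolding linked_def
  proof (intro conjI allI impI)
    have xyz: "x \<in> \<Omega>" "y \<in> \<Omega>" "z \<in> \<Omega>" using assms by (simp_all add: linked_def)
    then show "x \<in> \<Omega>" "z \<in> \<Omega>" by blast+
    fix R assume R: "finite R" "x \<notin> R" "z \<notin> R"
    obtain k where k: "k \<in> K" "k y = z" "\<forall>r \<in> (insert x R - {y}) \<inter> \<Omega>. k r = r"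
      using assms(2) R distinct unfolding linked_def by (metis Diff_iff finite_Diff finite_insert insertE singletonI)
    have kx: "k x = x" using k(3) xyz distinct by blast
    let ?k' = "inv\<^bsub>BijGroup \<Omega>\<^esub> k"
    let ?R = "{r \<in> \<Omega>. k r \<in> R}"
    have "x \<notin> ?R" "y \<notin> ?R" using kx k(2) R by auto
    then obtain h where h: "h \<in> K" "h x = y" "\<forall>r \<in> ?R \<inter> \<Omega>. h r = r"
      using assms(1) finite_preimage[OF k(1) R(1)] unfolding linked_def by meson
    have k': "?k' \<in> K" using inv_closed[OF k(1)] .
    have g: "(k \<otimes>\<^bsub>BijGroup \<Omega>\<^esub> (h \<otimes>\<^bsub>BijGroup \<Omega>\<^esub> ?k')) w = k (h (?k' w))" if "w \<in> \<Omega>" for w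
      using that k(1) h(1) k' mult_closed closed by (simp add: mult_apply del: carrier_DirProd)
    show "\<exists>h \<in> K. h x = z \<and> (\<forall>r \<in> R \<inter> \<Omega>. h r = r)"
    proof (intro bexI[of _ "k \<otimes>\<^bsub>BijGroup \<Omega>\<^esub> (h \<otimes>\<^bsub>BijGroup \<Omega>\<^esub> ?k')"] conjI ballI)
      have "?k' x = x" using inv_apply[OF k(1) xyz(1)] kx by simp
      then show "(k \<otimes>\<^bsub>BijGroup \<Omega>\<^esub> (h \<otimes>\<^bsub>BijGroup \<Omega>\<^esub> ?k')) x = z"
        using g[OF xyz(1)] h(2) k(2) by simp
      show "k \<otimes>\<^bsub>BijGroup \<Omega>\<^esub> (h \<otimes>\<^bsub>BijGroup \<Omega>\<^esub> ?k') \<in> K" using k(1) h(1) k' mult_closed by blast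
      fix r assume r: "r \<in> R \<inter> \<Omega>"
      then have "?k' r \<in> \<Omega>" "k (?k' r) = r" using closed[OF k'] apply_inv[OF k(1)] by blast+
      moreover from this have "h (?k' r) = ?k' r" using h(3) r by simp
      ultimately show "(k \<otimes>\<^bsub>BijGroup \<Omega>\<^esub> (h \<otimes>\<^bsub>BijGroup \<Omega>\<^esub> ?k')) r = r" using g r by simp
    qed
  qed
qed

text \<open>Conjugation by \<open>T g\<close>, with \<open>R\<close> replaced by its
  preimage.\<close>

lemma linked_T:
  assumes "linked x y" "g \<in> \<Omega>"
  shows "linked (T g x) (T g y)"
  unfolding linked_def
proof (intro conjI allI impI)
  have xy: "x \<in> \<Omega>" "y \<in> \<Omega>" using assms by (simp_all add: linked_def)
  have t: "T g \<in> K" using T_K[OF assms(2)] .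
  show "T g x \<in> \<Omega>" "T g y \<in> \<Omega>" using closed[OF t] xy by blast+
  fix R assume R: "finite R" "T g x \<notin> R" "T g y \<notin> R"
  let ?t' = "inv\<^bsub>BijGroup \<Omega>\<^esub> (T g)"
  let ?R = "{r \<in> \<Omega>. T g r \<in> R}"
  obtain h where h: "h \<in> K" "h x = y" "\<forall>r \<in> ?R \<inter> \<Omega>. h r = r"
    using assms(1) finite_preimage[OF t R(1)] R(2,3) unfolding linked_def by (metis (mono_tags, lifting) mem_Collect_eq)
  have t': "?t' \<in> K" using inv_closed[OF t] .
  have c: "(T g \<otimes>\<^bsub>BijGroup \<Omega>\<^esub> (h \<otimes>\<^bsub>BijGroup \<Omega>\<^esub> ?t')) w = T g (h (?t' w))" if "w \<in> \<Omega>" for w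
    using that t h(1) t' mult_closed closed by (simp add: mult_apply del: carrier_DirProd)
  show "\<exists>h \<in> K. h (T g x) = T g y \<and> (\<forall>r \<in> R \<inter> \<Omega>. h r = r)"
  proof (intro bexI[of _ "T g \<otimes>\<^bsub>BijGroup \<Omega>\<^esub> (h \<otimes>\<^bsub>BijGroup \<Omega>\<^esub> ?t')"] conjI ballI)
    show "(T g \<otimes>\<^bsub>BijGroup \<Omega>\<^esub> (h \<otimes>\<^bsub>BijGroup \<Omega>\<^esub> ?t')) (T g x) = T g y"
      using c[OF closed[OF t xy(1)]] inv_apply[OF t xy(1)] h(2) by simp
    show "T g \<otimes>\<^bsub>BijGroup \<Omega>\<^esub> (h \<otimes>\<^bsub>BijGroup \<Omega>\<^esub> ?t') \<in> K" using t h(1) t' mult_closed by blast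
    fix r assume r: "r \<in> R \<inter> \<Omega>"
    then have "?t' r \<in> \<Omega>" "T g (?t' r) = r" using closed[OF t'] apply_inv[OF t] by blast+
    moreover from this have "h (?t' r) = ?t' r" using h(3) r by simp
    ultimately show "(T g \<otimes>\<^bsub>BijGroup \<Omega>\<^esub> (h \<otimes>\<^bsub>BijGroup \<Omega>\<^esub> ?t')) r = r" using c r by simp
  qed
qed

text \<open>Induction along a product of generators: translating a link from the identity to
  \<open>h\<close> by \<open>g\<close> gives a link from \<open>g\<close> to
  \<open>g h\<close>.\<close>

lemma linked_one: "g \<in> \<Omega> \<Longrightarrow> linked \<one>\<^bsub>L\<^esub> g"
proof -
  assume "g \<in> \<Omega>"
  then have "g \<in> generate L U" by (simp only: generate_U)
  then show ?thesis
  proof induction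
    case one
    show ?case by (rule linked_refl) (rule L.one_closed)
  next
    case (incl u)
    then show ?case using linked_U by simp
  next
    case (inv u)
    have u: "u \<in> \<Omega>" using inv U_closed by blast
    have "linked (T (inv\<^bsub>L\<^esub> u) \<one>\<^bsub>L\<^esub>) (T (inv\<^bsub>L\<^esub> u) u)"
      using linked_T[OF linked_U[OF inv] L.inv_closed[OF u]] by simp
    then show ?case using u linked_sym by (simp add: T_apply' del: carrier_DirProd one_DirProd)
  next
    case (eng g h)
    then have "g \<in> \<Omega>" "h \<in> \<Omega>" using generate_U by blast+
    then have "linked g (g \<otimes>\<^bsub>L\<^esub> h)"
      using linked_T[OF eng.IH(2), of g] by (simp add: T_apply' del: carrier_DirProd one_DirProd)
    then show ?case using linked_trans eng.IH(1) by blast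
  qed
qed

lemma infinite_\<Omega>: "infinite \<Omega>"
proof -
  have "infinite (range (\<lambda>n :: nat. (\<one>, int n)))"
    by (rule range_inj_infinite) (simp add: inj_def)
  then show ?thesis by (rule infinite_super[rotated]) auto
qed

lemma highly_transitive: "highly_transitive_action H \<Omega> (\<lambda>h. h)"
proof (rule highly_transitive_actionI[OF infinite_\<Omega>])
  fix R x y assume *: "finite R" "x \<in> \<Omega> - R" "y \<in> \<Omega> - R"
  then have "linked x y" using linked_trans[OF linked_sym] linked_one by blast
  then show "\<exists>h \<in> K. h x = y \<and> (\<forall>r \<in> R \<inter> \<Omega>. h r = r)"
    using * unfolding linked_def by blast
qed


section \<open>Agreement with a translation away from the sparse set\<close>

subsection \<open>Germs\<close>

text \<open>The image is constrained together with the point. This makes the condition stable under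
  inversion and later keeps an exceptional point and its image in one block.\<close>

definition exceptional :: "'a set \<Rightarrow> int \<Rightarrow> 'a \<times> int \<Rightarrow> 'a \<times> int \<Rightarrow> bool" where
  "exceptional C r x x' \<longleftrightarrow> fst x \<in> C \<and> fst x' \<in> C \<and> (\<exists>s \<in> sparse_set. \<bar>snd x - s\<bar> \<le> r) \<and> \<bar>snd x' - snd x\<bar> \<le> r"

text \<open>\<open>C\<close> and \<open>r\<close> are existential because they may grow under
  products and inverses; only \<open>g\<close> is determined by \<open>h\<close>.\<close>

definition germ :: "('a \<times> int \<Rightarrow> 'a \<times> int) \<Rightarrow> 'a \<times> int \<Rightarrow> bool" where
  "germ h g \<longleftrightarrow> g \<in> \<Omega> \<and> (\<exists>C r. finite C \<and> C \<subseteq> carrier G \<and> (\<forall>x \<in> \<Omega>. h x = g \<otimes>\<^bsub>L\<^esub> x \<or> exceptional C r x (h x)))"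

lemma exceptional_mono: "exceptional C r x x' \<Longrightarrow> C \<subseteq> C' \<Longrightarrow> r \<le> r' \<Longrightarrow> exceptional C' r' x x'"
  unfolding exceptional_def by force

text \<open>The sparse set is bounded below, so the germ is read off near \<open>-\<infinity>\<close> in the second coordinate.\<close>

lemma germ_unique:
  assumes "germ h g" "germ h g'"
  shows "g = g'"
proof -
  obtain C r where 1: "\<forall>x \<in> \<Omega>. h x = g \<otimes>\<^bsub>L\<^esub> x \<or> exceptional C r x (h x)"
    using assms(1) unfolding germ_def by blast
  obtain C' r' where 2: "\<forall>x \<in> \<Omega>. h x = g' \<otimes>\<^bsub>L\<^esub> x \<or> exceptional C' r' x (h x)"
    using assms(2) unfolding germ_def by blast
  define x where "x = (\<one>, - \<bar>r\<bar> - \<bar>r'\<bar> - 1)"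
  have x: "x \<in> \<Omega>" by (simp add: x_def)
  have "\<not> exceptional C r x (h x)" "\<not> exceptional C' r' x (h x)"
    using sparse_set_nonneg by (force simp: exceptional_def x_def)+
  then have "g \<otimes>\<^bsub>L\<^esub> x = g' \<otimes>\<^bsub>L\<^esub> x" using 1 2 x by metis
  then show ?thesis using assms x L.right_cancel unfolding germ_def by blast
qed

lemma germ_T: "g \<in> \<Omega> \<Longrightarrow> germ (T g) g"
  unfolding germ_def by (intro conjI exI[of _ "{}"]) (simp_all add: T_apply' del: carrier_DirProd)

lemma germ_swap:
  assumes "admissible u"
  shows "germ (swap 0 u) \<one>\<^bsub>L\<^esub>"
proof -
  obtain g i where u: "u = (g, i)" "g \<in> carrier G" using assms by (cases u) (auto simp: admissible_def)
  have "swap 0 u x = \<one>\<^bsub>L\<^esub> \<otimes>\<^bsub>L\<^esub> x \<or> exceptional {\<one>, g} \<bar>i\<bar> x (swap 0 u x)" if "x \<in> \<Omega>" for x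
    unfolding u(1)
  proof (cases rule: swap_cases[OF that, of 0 g i, case_names base target other])
    case (base n)
    then show "swap 0 (g, i) x = \<one>\<^bsub>L\<^esub> \<otimes>\<^bsub>L\<^esub> x \<or> exceptional {\<one>, g} \<bar>i\<bar> x (swap 0 (g, i) x)"
      unfolding exceptional_def by (intro disjI2 conjI bexI[of _ n]) auto
  next
    case (target n)
    then show "swap 0 (g, i) x = \<one>\<^bsub>L\<^esub> \<otimes>\<^bsub>L\<^esub> x \<or> exceptional {\<one>, g} \<bar>i\<bar> x (swap 0 (g, i) x)"
      unfolding exceptional_def by (intro disjI2 conjI bexI[of _ n]) auto
  next
    case other
    then show "swap 0 (g, i) x = \<one>\<^bsub>L\<^esub> \<otimes>\<^bsub>L\<^esub> x \<or> exceptional {\<one>, g} \<bar>i\<bar> x (swap 0 (g, i) x)"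
      using L.l_one[OF that] by metis
  qed
  then show ?thesis
    unfolding germ_def using u(2) by (intro conjI exI[of _ "{\<one>, g}"] exI[of _ "\<bar>i\<bar>"]) auto
qed

text \<open>The product is a translation at \<open>x\<close> if \<open>k\<close> is one at
  \<open>x\<close> and \<open>h\<close> is one at \<open>k x\<close>. In the three remaining cases
  an enlarged exceptional set contains both the point and its image.\<close>

lemma germ_mult:
  assumes "h \<in> K" "k \<in> K" "germ h g" "germ k g'"
  shows "germ (h \<otimes>\<^bsub>BijGroup \<Omega>\<^esub> k) (g \<otimes>\<^bsub>L\<^esub> g')"
proof -
  obtain C r where 1: "finite C" "C \<subseteq> carrier G" "\<forall>x \<in> \<Omega>. h x = g \<otimes>\<^bsub>L\<^esub> x \<or> exceptional C r x (h x)"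
    using assms(3) unfolding germ_def by blast
  obtain C' r' where 2: "finite C'" "C' \<subseteq> carrier G" "\<forall>x \<in> \<Omega>. k x = g' \<otimes>\<^bsub>L\<^esub> x \<or> exceptional C' r' x (k x)"
    using assms(4) unfolding germ_def by blast
  obtain a i where g: "g = (a, i)" "a \<in> carrier G" using assms(3) unfolding germ_def by auto
  obtain a' i' where g': "g' = (a', i')" "a' \<in> carrier G" using assms(4) unfolding germ_def by auto
  \<comment> \<open>The first translate contains the points that the regular part of
    \<open>k\<close> carries into \<open>C\<close>, the second the images of \<open>C'\<close> under
    the regular part of \<open>h\<close>.\<close>
  define D where "D = C \<union> C' \<union> (\<lambda>y. inv a' \<otimes> y) ` C \<union> (\<lambda>y. a \<otimes> y) ` C'"
  define q where "q = \<bar>r\<bar> + \<bar>r'\<bar> + \<bar>i\<bar> + \<bar>i'\<bar>"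
  have "(h \<otimes>\<^bsub>BijGroup \<Omega>\<^esub> k) x = (g \<otimes>\<^bsub>L\<^esub> g') \<otimes>\<^bsub>L\<^esub> x \<or>
      exceptional D q x ((h \<otimes>\<^bsub>BijGroup \<Omega>\<^esub> k) x)" if x: "x \<in> \<Omega>" for x
  proof -
    obtain y n where y: "x = (y, n)" "y \<in> carrier G" using x by auto
    obtain y' n' where y': "k x = (y', n')" "y' \<in> carrier G" using closed[OF assms(2) x] by (cases "k x") auto
    have hk: "(h \<otimes>\<^bsub>BijGroup \<Omega>\<^esub> k) x = h (k x)" using mult_apply[OF assms(1,2) x] .
    have kx: "k x \<in> \<Omega>" using closed[OF assms(2) x] .
    consider (reg) "k x = g' \<otimes>\<^bsub>L\<^esub> x" "h (k x) = g \<otimes>\<^bsub>L\<^esub> k x"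
      | (exc_h) "k x = g' \<otimes>\<^bsub>L\<^esub> x" "exceptional C r (k x) (h (k x))"
      | (exc_k) "exceptional C' r' x (k x)" "h (k x) = g \<otimes>\<^bsub>L\<^esub> k x"
      | (exc) "exceptional C' r' x (k x)" "exceptional C r (k x) (h (k x))"
      using 1(3) 2(3) x kx by blast
    then show ?thesis
    proof cases
      case reg
      then show ?thesis using hk g g' y by (simp add: m_assoc)
    next
      case exc_h
      have "y' = a' \<otimes> y" "n' = i' + n" using exc_h(1) y' y g' by simp_all
      then have "y = inv a' \<otimes> y'" using g' y by (simp flip: m_assoc)
      obtain s where s: "s \<in> sparse_set" "\<bar>n' - s\<bar> \<le> r" "y' \<in> C" "fst (h (k x)) \<in> C"
        "\<bar>snd (h (k x)) - n'\<bar> \<le> r"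
        using exc_h(2) y' by (auto simp: exceptional_def)
      have "y \<in> D" using \<open>y = inv a' \<otimes> y'\<close> s(3) unfolding D_def by blast
      moreover have "fst (h (k x)) \<in> D" using s(4) by (simp add: D_def)
      moreover have "\<bar>n - s\<bar> \<le> q" "\<bar>snd (h (k x)) - n\<bar> \<le> q"
        using s(2,5) \<open>n' = i' + n\<close> by (simp_all add: q_def)
      ultimately show ?thesis
        using s(1) y hk unfolding exceptional_def by (intro disjI2 conjI bexI[of _ s]) simp_all
    next
      case exc_k
      obtain s where s: "s \<in> sparse_set" "\<bar>n - s\<bar> \<le> r'" "y \<in> C'" "y' \<in> C'" "\<bar>n' - n\<bar> \<le> r'"
        using exc_k(1) y y' by (auto simp: exceptional_def)
      have "fst (h (k x)) = a \<otimes> y'" "snd (h (k x)) = i + n'" using exc_k(2) y' g by simp_all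
      moreover from this have "fst (h (k x)) \<in> D" using s(4) unfolding D_def by blast
      moreover have "y \<in> D" using s(3) by (simp add: D_def)
      moreover have "\<bar>n - s\<bar> \<le> q" "\<bar>(i + n') - n\<bar> \<le> q"
        using s(2,5) by (simp_all add: q_def)
      ultimately show ?thesis
        using s(1) y hk unfolding exceptional_def by (intro disjI2 conjI bexI[of _ s]) simp_all
    next
      case exc
      obtain s where s: "s \<in> sparse_set" "\<bar>n - s\<bar> \<le> r'" "y \<in> C'" "\<bar>n' - n\<bar> \<le> r'"
        using exc(1) y y' by (auto simp: exceptional_def)
      have "fst (h (k x)) \<in> C" "\<bar>snd (h (k x)) - n'\<bar> \<le> r"
        using exc(2) y' by (auto simp: exceptional_def)
      then have "fst (h (k x)) \<in> D" "\<bar>snd (h (k x)) - n\<bar> \<le> q" using s(4) by (simp_all add: D_def q_def)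
      moreover have "y \<in> D" "\<bar>n - s\<bar> \<le> q" using s(2,3) by (simp_all add: D_def q_def)
      ultimately show ?thesis
        using s(1) y hk unfolding exceptional_def by (intro disjI2 conjI bexI[of _ s]) simp_all
    qed
  qed
  moreover have "finite D" "D \<subseteq> carrier G" using 1(1,2) 2(1,2) g g' by (auto simp: D_def)
  moreover have "g \<otimes>\<^bsub>L\<^esub> g' \<in> \<Omega>" using g g' by simp
  ultimately show ?thesis unfolding germ_def by blast
qed

lemma germ_inv:
  assumes "h \<in> K" "germ h g"
  shows "germ (inv\<^bsub>BijGroup \<Omega>\<^esub> h) (inv\<^bsub>L\<^esub> g)"
proof -
  obtain C r where 1: "finite C" "C \<subseteq> carrier G" "\<forall>x \<in> \<Omega>. h x = g \<otimes>\<^bsub>L\<^esub> x \<or> exceptional C r x (h x)"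
    using assms(2) unfolding germ_def by blast
  have g: "g \<in> \<Omega>" using assms(2) unfolding germ_def by blast
  let ?h' = "inv\<^bsub>BijGroup \<Omega>\<^esub> h"
  \<comment> \<open>The radius doubles because the distance to the sparse set is now measured from
    the image under \<open>h\<close>.\<close>
  have "?h' x = inv\<^bsub>L\<^esub> g \<otimes>\<^bsub>L\<^esub> x \<or> exceptional C (2 * \<bar>r\<bar>) x (?h' x)" if x: "x \<in> \<Omega>" for x
  proof -
    have z: "?h' x \<in> \<Omega>" "h (?h' x) = x" using closed[OF inv_closed[OF assms(1)] x] apply_inv[OF assms(1) x] .
    from 1(3) z consider "x = g \<otimes>\<^bsub>L\<^esub> ?h' x" | "exceptional C r (?h' x) x" by metis
    then show ?thesis
    proof cases
      case 1
      then show ?thesis using L.inv_solve_left[OF g z(1) x] L.inv_solve_left'[OF z(1) g x] by metis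
    next
      case 2
      then obtain s where "s \<in> sparse_set" "\<bar>snd (?h' x) - s\<bar> \<le> r" "\<bar>snd x - snd (?h' x)\<bar> \<le> r"
        "fst x \<in> C" "fst (?h' x) \<in> C" by (auto simp: exceptional_def)
      then show ?thesis unfolding exceptional_def by (intro disjI2 conjI bexI[of _ s]) auto
    qed
  qed
  then show ?thesis unfolding germ_def using 1(1,2) L.inv_closed[OF g] by blast
qed

section \<open>Eventual commutation with translations by powers of 4\<close>

subsection \<open>Recurrence\<close>

definition shift :: "nat \<Rightarrow> 'a \<times> int \<Rightarrow> 'a \<times> int" where
  "shift k x = (fst x, snd x + 4 ^ k)"

text \<open>The threshold for \<open>k\<close> may depend on \<open>x\<close>. A product then needs
  only the thresholds at \<open>x\<close> and at its image.\<close>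

definition recurrent :: "('a \<times> int \<Rightarrow> 'a \<times> int) \<Rightarrow> bool" where
  "recurrent h \<longleftrightarrow> (\<forall>x \<in> \<Omega>. eventually (\<lambda>k. h (shift k x) = shift k (h x)) sequentially)"

lemma shift_closed: "shift k x \<in> \<Omega> \<longleftrightarrow> x \<in> \<Omega>"
  by (cases x) (simp add: shift_def)

lemma recurrent_T: "recurrent (T g)"
  unfolding recurrent_def by (cases g) (auto simp: T_apply shift_def)

text \<open>A swap acts on a point according to two membership tests in the sparse set, and both are
  eventually unaffected by the shift.\<close>

lemma recurrent_swap:
  assumes "admissible u"
  shows "recurrent (swap 0 u)"
  unfolding recurrent_def
proof
  fix x assume "x \<in> \<Omega>"
  then obtain y n where x: "x = (y, n)" "y \<in> carrier G" by auto
  show "eventually (\<lambda>k. swap 0 u (shift k x) = shift k (swap 0 u x)) sequentially"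
    using sparse_set_recurrent[of n] sparse_set_recurrent[of "n - snd u"]
  proof eventually_elim
    case (elim k)
    have "n + 4 ^ k - snd u = n - snd u + 4 ^ k" by simp
    then have "n + 4 ^ k - snd u \<in> sparse_set \<longleftrightarrow> n - snd u \<in> sparse_set" using elim(2) by metis
    then show ?case using elim(1) x assms by (simp add: swap_def shift_def admissible_def)
  qed
qed

lemma recurrent_mult:
  assumes "h \<in> K" "k \<in> K" "recurrent h" "recurrent k"
  shows "recurrent (h \<otimes>\<^bsub>BijGroup \<Omega>\<^esub> k)"
  unfolding recurrent_def
proof
  fix x assume x: "x \<in> \<Omega>"
  have "eventually (\<lambda>n. k (shift n x) = shift n (k x)) sequentially"
    "eventually (\<lambda>n. h (shift n (k x)) = shift n (h (k x))) sequentially"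
    using assms(3,4) x closed[OF assms(2) x] unfolding recurrent_def by blast+
  then show "eventually (\<lambda>n. (h \<otimes>\<^bsub>BijGroup \<Omega>\<^esub> k) (shift n x) = shift n ((h \<otimes>\<^bsub>BijGroup \<Omega>\<^esub> k) x)) sequentially"
  proof eventually_elim
    case (elim n)
    have "shift n x \<in> \<Omega>" using x shift_closed by blast
    then show ?case using mult_apply[OF assms(1,2)] x elim by metis
  qed
qed

lemma recurrent_inv:
  assumes "h \<in> K" "recurrent h"
  shows "recurrent (inv\<^bsub>BijGroup \<Omega>\<^esub> h)"
  unfolding recurrent_def
proof
  let ?h' = "inv\<^bsub>BijGroup \<Omega>\<^esub> h"
  fix x assume x: "x \<in> \<Omega>"
  have z: "?h' x \<in> \<Omega>" "h (?h' x) = x" using closed[OF inv_closed[OF assms(1)] x] apply_inv[OF assms(1) x] .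
  have "eventually (\<lambda>n. h (shift n (?h' x)) = shift n (h (?h' x))) sequentially"
    using assms(2) z(1) unfolding recurrent_def by blast
  then show "eventually (\<lambda>n. ?h' (shift n x) = shift n (?h' x)) sequentially"
  proof eventually_elim
    case (elim n)
    have "shift n (?h' x) \<in> \<Omega>" using z(1) shift_closed by blast
    then show ?case using inv_apply[OF assms(1)] elim z(2) by metis
  qed
qed

lemma germ_recurrent:
  assumes "h \<in> K"
  shows "(\<exists>g. germ h g) \<and> recurrent h"
proof -
  have gen: "(\<exists>g. germ h g) \<and> recurrent h" if "h \<in> generators" for h
    using that U_closed V_admissible germ_T germ_swap recurrent_T recurrent_swap
    unfolding generators_def by blast
  have "h \<in> generate (BijGroup \<Omega>) generators" using assms by (simp add: K_def)
  then show ?thesis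
  proof induction
    case one
    have "T \<one>\<^bsub>L\<^esub> = \<one>\<^bsub>BijGroup \<Omega>\<^esub>"
      by (rule eqI[OF T_K[OF L.one_closed] one_closed])
        (simp add: T_apply' one_apply del: carrier_DirProd one_DirProd)
    then show ?case using germ_T[OF L.one_closed] recurrent_T by metis
  next
    case (incl h)
    then show ?case by (rule gen)
  next
    case (inv h)
    then show ?case using gen germ_inv recurrent_inv generators_K by blast
  next
    case (eng h k)
    then have "h \<in> K" "k \<in> K" by (simp_all add: K_def)
    then show ?case using eng.IH germ_mult recurrent_mult by blast
  qed
qed

text \<open>If \<open>x\<close> is moved, then so are its shifts by all sufficiently large powers of
  4.\<close>

lemma infinite_support:
  assumes "h \<in> K" "h \<noteq> \<one>\<^bsub>BijGroup \<Omega>\<^esub>"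
  shows "infinite {x \<in> \<Omega>. h x \<noteq> x}"
proof -
  obtain x where x: "x \<in> \<Omega>" "h x \<noteq> x" using nontrivial_moves[OF assms] .
  have inj_shift: "shift k z = shift k w \<Longrightarrow> z = w" for k z w
    by (cases z; cases w) (simp add: shift_def)
  obtain N where N: "\<And>k. k \<ge> N \<Longrightarrow> h (shift k x) = shift k (h x)"
    using germ_recurrent[OF assms(1)] x(1) unfolding recurrent_def eventually_sequentially by blast
  have "inj (\<lambda>k. shift k x)"
    by (rule injI) (simp add: shift_def)
  then have "infinite ((\<lambda>k. shift k x) ` {N..})"
    by (meson finite_imageD inj_on_subset infinite_Ici subset_UNIV)
  moreover have "(\<lambda>k. shift k x) ` {N..} \<subseteq> {x \<in> \<Omega>. h x \<noteq> x}"
  proof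
    fix z assume "z \<in> (\<lambda>k. shift k x) ` {N..}"
    then obtain k where "k \<ge> N" "z = shift k x" by auto
    then show "z \<in> {x \<in> \<Omega>. h x \<noteq> x}"
      using N x shift_closed inj_shift by (metis (mono_tags, lifting) mem_Collect_eq)
  qed
  ultimately show ?thesis using finite_subset by blast
qed

section \<open>The surjection onto the direct product and the local finiteness of its kernel\<close>

subsection \<open>The quotient map and its kernel\<close>

definition germ_of :: "('a \<times> int \<Rightarrow> 'a \<times> int) \<Rightarrow> 'a \<times> int" where
  "germ_of h = (THE g. germ h g)"

lemma germ_of_eq: "germ h g \<Longrightarrow> germ_of h = g"
  unfolding germ_of_def using germ_unique by blast

lemma germ_germ_of: "h \<in> K \<Longrightarrow> germ h (germ_of h)"
  using germ_recurrent germ_of_eq by blast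

text \<open>Multiplicativity combines \<open>germ_mult\<close> with uniqueness of germs;
  surjectivity holds because \<open>T g\<close> has germ \<open>g\<close>.\<close>

lemma germ_of_epi: "germ_of \<in> epi H L"
proof -
  have "germ_of \<in> hom H L"
  proof (rule homI)
    fix h assume "h \<in> carrier H"
    then show "germ_of h \<in> \<Omega>" using germ_germ_of unfolding germ_def by simp
  next
    fix h k assume "h \<in> carrier H" "k \<in> carrier H"
    then show "germ_of (h \<otimes>\<^bsub>H\<^esub> k) = germ_of h \<otimes>\<^bsub>L\<^esub> germ_of k"
      using germ_of_eq[OF germ_mult] germ_germ_of by simp
  qed
  moreover have "\<Omega> \<subseteq> germ_of ` K"
  proof
    fix g assume "g \<in> \<Omega>"
    then show "g \<in> germ_of ` K" using germ_of_eq[OF germ_T] T_K by (metis imageI)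
  qed
  ultimately show ?thesis by (simp add: epi_iff_subset del: carrier_DirProd)
qed

text \<open>Blocks of length \<open>P = 4\<^sup>k\<close>, \<open>k\<close> large, in the second coordinate: modulo \<open>P\<close> the sparse set
  occupies only the first third of a block, so short moves near it do not leave the block.\<close>

lemma same_block:
  assumes s: "s \<in> sparse_set" "\<bar>n - s\<bar> \<le> r" and s': "s' \<in> sparse_set" "\<bar>n' - s'\<bar> \<le> r"
    and "\<bar>n' - n\<bar> \<le> r" and r: "6 * r < 4 ^ k"
  shows "(n' + r) div 4 ^ k = (n + r) div 4 ^ k"
proof -
  define P :: int where "P = 4 ^ k"
  have P: "0 < P" by (simp add: P_def)
  \<comment> \<open>The residue of \<open>s\<close> is below a third of \<open>P\<close>, and the
    offset from \<open>s\<close> is at most \<open>2 * r\<close>, again below a third.\<close>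
  have low: "3 * ((n + r) mod P) < 2 * P" if "s \<in> sparse_set" "\<bar>n - s\<bar> \<le> r" for n s
  proof -
    have m: "3 * (s mod P) < P" "0 \<le> s mod P" using sparse_set_mod[OF that(1), of k] P by (simp_all add: P_def)
    define d where "d = n + r - s"
    have d: "0 \<le> d" "d \<le> 2 * r" using that(2) by (simp_all add: d_def)
    have "(n + r) mod P = (s mod P + d) mod P" by (simp add: d_def mod_simps)
    also have "\<dots> = s mod P + d" using m d r by (intro mod_pos_pos_trivial) (simp_all add: P_def)
    finally show ?thesis using m d r by (simp add: P_def)
  qed
  define m m' where "m = n + r" and "m' = n' + r"
  \<comment> \<open>A residue in the first two thirds and a step of less than \<open>P / 6\<close>
    cannot reach the next block.\<close>
  have aux: "P * (b div P) - P * (a div P) < P"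
    if "3 * (a mod P) < 2 * P" "6 * b - 6 * a < P" for a b
  proof -
    have "P * (b div P) - P * (a div P) = (b - a) + a mod P - b mod P"
      using mult_div_mod_eq[of P a] mult_div_mod_eq[of P b] by linarith
    moreover have "0 \<le> b mod P" using P by simp
    ultimately show ?thesis using that P by linarith
  qed
  have "3 * (m mod P) < 2 * P" "3 * (m' mod P) < 2 * P"
    using low[OF s] low[OF s'] by (simp_all add: m_def m'_def)
  moreover have "6 * m' - 6 * m < P" "6 * m - 6 * m' < P"
    using assms(5) r by (simp_all add: m_def m'_def P_def)
  ultimately have "P * (m' div P) - P * (m div P) < P" "P * (m div P) - P * (m' div P) < P"
    using aux by blast+
  then have "P * (m' div P - m div P) < P * 1" "P * (m div P - m' div P) < P * 1"
    by (simp_all only: right_diff_distrib mult_1_right)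
  then have "m' div P - m div P < 1" "m div P - m' div P < 1"
    using P by (simp_all only: mult_less_cancel_left_pos)
  then show ?thesis by (simp add: m_def m'_def P_def)
qed

text \<open>Finitely many elements share one pair \<open>C\<close>, \<open>r\<close>. For a large
  power of 4 they preserve each product of \<open>C\<close> with a block of that length and fix
  every point whose first coordinate is outside \<open>C\<close>.\<close>

lemma finite_generate_germ_one:
  assumes F: "finite F" "F \<subseteq> K" and one: "\<And>t. t \<in> F \<Longrightarrow> germ t \<one>\<^bsub>L\<^esub>"
  shows "finite (generate (BijGroup \<Omega>) F)"
proof -
  have "\<exists>C r. finite C \<and> C \<subseteq> carrier G \<and> (\<forall>t \<in> F. \<forall>x \<in> \<Omega>. t x = x \<or> exceptional C r x (t x))"
    using F(1) one
  proof (induction F rule: finite_induct)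
    case empty
    then show ?case by (intro exI[of _ "{}"]) simp
  next
    case (insert t F)
    then obtain C r where C: "finite C" "C \<subseteq> carrier G" "\<forall>t \<in> F. \<forall>x \<in> \<Omega>. t x = x \<or> exceptional C r x (t x)"
      by blast
    obtain C' r' where C': "finite C'" "C' \<subseteq> carrier G" "\<forall>x \<in> \<Omega>. t x = \<one>\<^bsub>L\<^esub> \<otimes>\<^bsub>L\<^esub> x \<or> exceptional C' r' x (t x)"
      using insert.prems[of t] unfolding germ_def by blast
    then have "\<forall>x \<in> \<Omega>. t x = x \<or> exceptional C' r' x (t x)" using L.l_one by metis
    then have "\<forall>t \<in> insert t F. \<forall>x \<in> \<Omega>. t x = x \<or> exceptional (C \<union> C') (max r r') x (t x)"
      using C(3) exceptional_mono[of _ _ _ _ "C \<union> C'" "max r r'"] by (metis Un_upper1 Un_upper2 insertE max.cobounded1 max.cobounded2)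
    then show ?case using C(1,2) C'(1,2) by (intro exI[of _ "C \<union> C'"] exI[of _ "max r r'"]) simp
  qed
  then obtain C r where C: "finite C" "C \<subseteq> carrier G"
    and exc: "\<And>t x. t \<in> F \<Longrightarrow> x \<in> \<Omega> \<Longrightarrow> t x = x \<or> exceptional C r x (t x)" by blast
  \<comment> \<open>A point and its image lie within \<open>R\<close> of the same member of the
    sparse set, as \<open>same_block\<close> requires.\<close>
  define R where "R = 2 * \<bar>r\<bar>"
  obtain k where k: "6 * R < 4 ^ k"
    using eventually_happens'[OF sequentially_bot eventually_less_power4] by blast
  define P :: int where "P = 4 ^ k"
  have P: "0 < P" by (simp add: P_def)
  \<comment> \<open>Coordinates on block \<open>q\<close>. The offset \<open>R\<close> agrees with
    \<open>same_block\<close>, so no neighbourhood of the sparse set straddles a block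
    boundary.\<close>
  define \<sigma> where "\<sigma> q = (\<lambda>(c :: 'a, i). (c, q * P + i - R))" for q
  have block: "x \<in> \<sigma> q ` (C \<times> {0..<P}) \<longleftrightarrow> fst x \<in> C \<and> (snd x + R) div P = q" for x q
  proof
    assume "x \<in> \<sigma> q ` (C \<times> {0..<P})"
    then obtain c i where "x = (c, q * P + i - R)" "c \<in> C" "0 \<le> i" "i < P" by (auto simp: \<sigma>_def)
    then show "fst x \<in> C \<and> (snd x + R) div P = q" by (simp add: div_pos_pos_trivial)
  next
    assume *: "fst x \<in> C \<and> (snd x + R) div P = q"
    have "x = \<sigma> q (fst x, (snd x + R) mod P)"
      using * div_mult_mod_eq[of "snd x + R" P] by (cases x) (simp add: \<sigma>_def)
    moreover have "(fst x, (snd x + R) mod P) \<in> C \<times> {0..<P}" using * P by simp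
    ultimately show "x \<in> \<sigma> q ` (C \<times> {0..<P})" by blast
  qed
  have \<sigma>_\<Omega>: "\<sigma> q ` (C \<times> {0..<P}) \<subseteq> \<Omega>" for q using C(2) by (auto simp: \<sigma>_def)
  show ?thesis
  proof (rule finite_generate_of_blocks[where \<sigma> = \<sigma> and X = "C \<times> {0..<P}"])
    show "finite F" by fact
    show "F \<subseteq> Bij \<Omega>" using F(2) Bij by blast
    show "finite (C \<times> {0..<P})" using C(1) by simp
    show "inj_on (\<sigma> q) (C \<times> {0..<P})" for q by (auto simp: inj_on_def \<sigma>_def)
    show "\<sigma> q ` (C \<times> {0..<P}) \<subseteq> \<Omega>" for q by (rule \<sigma>_\<Omega>)
    show "t ` \<sigma> q ` (C \<times> {0..<P}) \<subseteq> \<sigma> q ` (C \<times> {0..<P})" if "t \<in> F" for t q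
    proof
      fix z assume "z \<in> t ` \<sigma> q ` (C \<times> {0..<P})"
      then obtain x where x: "x \<in> \<sigma> q ` (C \<times> {0..<P})" "z = t x" by blast
      from x(1) \<sigma>_\<Omega> have "x \<in> \<Omega>" by blast
      from exc[OF \<open>t \<in> F\<close> this] show "z \<in> \<sigma> q ` (C \<times> {0..<P})"
      proof
        assume "t x = x"
        then have "z = x" using x(2) by (rule trans[rotated])
        then show ?thesis using x(1) by simp
      next
        assume e: "exceptional C r x (t x)"
        then obtain s where s: "s \<in> sparse_set" "\<bar>snd x - s\<bar> \<le> r" by (auto simp: exceptional_def)
        have "\<bar>snd (t x) - snd x\<bar> \<le> r" using e by (simp add: exceptional_def)
        then have "(snd (t x) + R) div P = (snd x + R) div P"
          unfolding P_def using s k by (intro same_block[of s _ _ s]) (simp_all add: R_def)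
        then show ?thesis using x e unfolding block by (simp add: exceptional_def)
      qed
    qed
    show "t x = x" if "t \<in> F" "x \<in> \<Omega> - (\<Union>q. \<sigma> q ` (C \<times> {0..<P}))" for t x
    proof -
      have "x \<notin> \<sigma> ((snd x + R) div P) ` (C \<times> {0..<P})" using that(2) by blast
      then have "fst x \<notin> C" unfolding block by simp
      then show ?thesis using exc[OF that(1), of x] that(2) by (simp add: exceptional_def)
    qed
  qed
qed

text \<open>A finitely generated subgroup of the kernel is generated by finitely many elements with
  trivial germ, so it is finite by \<open>finite_generate_germ_one\<close>.\<close>

lemma kernel_short_exact:
  defines "N \<equiv> (BijGroup \<Omega>)\<lparr>carrier := kernel H L germ_of\<rparr>"
  shows "het_short_exact_sequence N (\<lambda>h. h) H germ_of L" "locally_finite N"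
proof -
  interpret p: group_hom H L germ_of
    using germ_of_epi H.is_group L.is_group by (simp only: group_hom_def group_hom_axioms_def epi_def) blast
  have sgH: "subgroup (kernel H L germ_of) H" by (rule p.subgroup_kernel)
  then have sg: "subgroup (kernel H L germ_of) (BijGroup \<Omega>)"
    using group.incl_subgroup[OF group_BijGroup subgroup_BijGroup] by blast
  have "(\<lambda>h. h) \<in> mon N H" by (auto simp: mon_def hom_def N_def kernel_def)
  moreover have "group N" unfolding N_def using subgroup.subgroup_is_group[OF sg group_BijGroup] .
  ultimately show "het_short_exact_sequence N (\<lambda>h. h) H germ_of L"
    using germ_of_epi by (simp add: het_short_exact_sequence_def H.is_group L.is_group N_def del: carrier_DirProd)
  show "locally_finite N"
    unfolding locally_finite_def
  proof (intro allI impI, elim conjE)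
    fix M assume M: "subgroup M N" "finitely_generated (N\<lparr>carrier := M\<rparr>)"
    have sgM: "subgroup M (BijGroup \<Omega>)"
      using group.incl_subgroup[OF group_BijGroup sg] M(1) by (simp add: N_def)
    obtain F where F: "finite F" "F \<subseteq> M" "generate ((BijGroup \<Omega>)\<lparr>carrier := M\<rparr>) F = M"
      using M(2) by (auto simp: finitely_generated_def N_def)
    have MN: "M \<subseteq> kernel H L germ_of" using subgroup.subset[OF M(1)] by (simp add: N_def)
    have "germ t \<one>\<^bsub>L\<^esub>" "t \<in> K" if "t \<in> F" for t
    proof -
      have "t \<in> K" "germ_of t = \<one>\<^bsub>L\<^esub>" using that F(2) MN by (auto simp: kernel_def)
      then show "germ t \<one>\<^bsub>L\<^esub>" "t \<in> K" using germ_germ_of[of t] by simp_all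
    qed
    then have "finite (generate (BijGroup \<Omega>) F)"
      using F(1) by (intro finite_generate_germ_one) auto
    then show "finite M"
      using F(3) group.generate_consistent[OF group_BijGroup F(2) sgM] by simp
  qed
qed

end

theorem theorem1p1:
  fixes G :: "('a, 'b) monoid_scheme"
  assumes "group G" and "finitely_generated G"
  shows "let L = G \<times>\<times> integer_group; \<Omega> = carrier L in
    \<exists>K. subgroup K (BijGroup \<Omega>) \<and>
        left_regular L ` ((\<lambda>g. (g, 0)) ` carrier G) \<subseteq> K \<and>
        (let H = (BijGroup \<Omega>)\<lparr>carrier := K\<rparr> in
          finitely_generated H \<and>
          (\<exists>(N :: ('a \<times> int \<Rightarrow> 'a \<times> int) monoid) i p.
             het_short_exact_sequence N i H p L \<and> locally_finite N) \<and>
          highly_transitive_action H \<Omega> (\<lambda>h. h) \<and>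
          mixed_identity_free H)"
proof -
  from assms(2) obtain Sg where Sg: "finite Sg" "Sg \<subseteq> carrier G" "generate G Sg = carrier G"
    unfolding finitely_generated_def by blast
  interpret shift_extension G Sg
    using assms(1) Sg by (simp add: shift_extension_def shift_extension_axioms_def)
  have "T ` ((\<lambda>g. (g, 0)) ` carrier G) \<subseteq> K" using T_K by auto
  moreover have "mixed_identity_free H"
    using mixed_identity_freeI[OF infinite_\<Omega> infinite_support highly_transitive] .
  ultimately show ?thesis
    unfolding Let_def
    by (intro exI[of _ K] conjI exI[of _ "(BijGroup \<Omega>)\<lparr>carrier := kernel H L germ_of\<rparr>"]
        exI[of _ "\<lambda>h. h"] exI[of _ germ_of] subgroup_BijGroup finitely_generated_H kernel_short_exact
        highly_transitive)
qed

end
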